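(* Let $x\in D_\infty$, $x>0$, and let $p\in\mathbb{R}$ with $0<p<1$. Then: (1) $(x^p)^{\frac1p}=x$. (2) If $x^{\frac1p}\ne0$ and $k:=\max\left\{\omega_2(x),\ \omega_2\left[\left(x^{\frac1p}\right)^p\right]\right\}$, then $\left(x^{\frac1p}\right)^p=_k x$.
   Context: Fermat reals. A little-oh polynomial is a function $x:\mathbb{R}_{\ge0}\to\mathbb{R}$ such that $x(t)=r+\sum_{i=1}^N a_i t^{\alpha_i}+o(t)$ as $t\to0^+$, for some $N\in\mathbb{N}$, $r,a_i\in\mathbb{R}$, $\alpha_i\in\mathbb{R}_{\ge0}$. Put $x\sim y$ iff $x(t)=y(t)+o(t)$ as $t\to0^+$. The ring ${}^\bullet\mathbb{R}$ of Fermat reals is the quotient of the ring of little-oh polynomials (pointwise operations) by $\sim$; it contains $\mathbb{R}$ (classes of constants). For real $a>0$, $\mathrm{d}t_a$ denotes the class of $t\mapsto t^{1/a}$ (so $\mathrm{d}t_a=0$ iff $a<1$). Every $x\in{}^\bullet\mathbb{R}$ can be written uniquely as $x={}^\circ x+\sum_{i=1}^{N_x}{}^\circ x_i\,\mathrm{d}t_{\omega_i(x)}$ with ${}^\circ x,{}^\circ x_i\in\mathbb{R}$, ${}^\circ x_i\ne0$, $\omega_1(x)>\dots>\omega_{N_x}(x)\ge1$, $N_x\ge0$ (the decomposition of $x$). Put $\omega_i(x):=0$ for $i>N_x$, and $\omega(x):=\omega_1(x)$ (the order). $D_\infty:=\{x\mid{}^\circ x=0\}$. Order relation: $x>0$ iff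 ${}^\circ x>0$, or ${}^\circ x=0$, $x\ne0$ and ${}^\circ x_1>0$; $x<y$ iff $y-x>0$. For $k\in\mathbb{R}_{\ge0}$, $x=_k y$ means ${}^\circ x={}^\circ y$ and $\omega(x-y)\le k$. Powers. For $a,b>0$ (possibly $\infty$, with $1/\infty=0$, $1/0=\infty$) put $a\ominus b:=(\frac1a-\frac1b)^{-1}$. For $y\in{}^\bullet\mathbb{R}$ with ${}^\circ y>0$ and $p\in\mathbb{R}$, $y^p$ is the class of $t\mapsto y(t)^p$; in particular $(1+h)^p=1+\sum_{n\ge1}\binom pn h^n$ (a finite sum) for $h\in D_\infty$. For $c\in D_\infty$, $c>0$, and $p\in\mathbb{R}_{>0}$, $$c^p:=({}^\circ c_1)^p\,\mathrm{d}t_{\frac{\omega(c)}p}\cdot\left(1+\sum_{i=2}^{N_c}\frac{{}^\circ c_i}{{}^\circ c_1}\,\mathrm{d}t_{\omega_i(c)\ominus\omega(c)}\right)^p .$$ *)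

theory Defs
  imports "HOL-Analysis.Analysis" "HOL-Library.Landau_Symbols"
begin

section \<open>Little-oh polynomials\<close>

text \<open>
  Functions on the nonnegative reals are represented by functions \<open>real \<Rightarrow> real\<close>. Everything below
  only depends on the germ at \<open>0\<^sup>+\<close>, so that the values at negative arguments are irrelevant: the
  equivalence relation identifies functions that only differ there.
\<close>

definition little_oh_poly :: "(real \<Rightarrow> real) \<Rightarrow> bool" where
  "little_oh_poly x \<longleftrightarrow> (\<exists>(N::nat) (r::real) (a::nat \<Rightarrow> real) (\<alpha>::nat \<Rightarrow> real).
     (\<forall>i\<in>{1..N}. \<alpha> i \<ge> 0) \<and>
     (\<lambda>t. x t - (r + (\<Sum>i=1..N. a i * t powr \<alpha> i))) \<in> o[at_right 0](\<lambda>t. t))"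

definition fermat_rel :: "(real \<Rightarrow> real) \<Rightarrow> (real \<Rightarrow> real) \<Rightarrow> bool" where
  "fermat_rel x y \<longleftrightarrow>
     little_oh_poly x \<and> little_oh_poly y \<and> (\<lambda>t. x t - y t) \<in> o[at_right 0](\<lambda>t. t)"

text \<open>Closure of little-oh polynomials under the ring operations.\<close>

inductive pure_poly :: "(real \<Rightarrow> real) \<Rightarrow> bool" where
  pure_poly_0: "pure_poly (\<lambda>t. 0)"
| pure_poly_step: "pure_poly f \<Longrightarrow> s \<ge> 0 \<Longrightarrow> pure_poly (\<lambda>t. a * t powr s + f t)"

lemma pure_poly_monom: "s \<ge> 0 \<Longrightarrow> pure_poly (\<lambda>t. a * t powr s)"
  using pure_poly_step[OF pure_poly_0] by simp

lemma pure_poly_add: "pure_poly f \<Longrightarrow> pure_poly g \<Longrightarrow> pure_poly (\<lambda>t. f t + g t)"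
proof (induction rule: pure_poly.induct)
  case (pure_poly_step f s a)
  from pure_poly.pure_poly_step[OF pure_poly_step.IH[OF pure_poly_step.prems] pure_poly_step.hyps(2), of a]
  show ?case by (simp add: add.assoc)
qed simp

lemma pure_poly_monom_mult:
  assumes "s \<ge> 0"
  shows "pure_poly f \<Longrightarrow> pure_poly (\<lambda>t. a * t powr s * f t)"
proof (induction rule: pure_poly.induct)
  case (pure_poly_step f s' a')
  have "pure_poly (\<lambda>t. a * a' * t powr (s + s') + a * t powr s * f t)"
    using pure_poly_step assms by (intro pure_poly.pure_poly_step) auto
  thus ?case by (simp add: algebra_simps powr_add)
qed (simp add: pure_poly_0)

lemma pure_poly_mult: "pure_poly f \<Longrightarrow> pure_poly g \<Longrightarrow> pure_poly (\<lambda>t. f t * g t)"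
proof (induction rule: pure_poly.induct)
  case (pure_poly_step f s a)
  have "pure_poly (\<lambda>t. a * t powr s * g t + f t * g t)"
    using pure_poly_step by (intro pure_poly_add pure_poly_monom_mult) auto
  thus ?case by (simp add: algebra_simps)
qed (simp add: pure_poly_0)

lemma pure_poly_const_add:
  assumes "pure_poly f"
  shows "pure_poly (\<lambda>t. r * t powr 0 + f t)"
  by (rule pure_poly_step[OF assms]) simp

lemma ev_right_pos: "eventually (\<lambda>t::real. t > 0) (at_right 0)"
  by (simp add: eventually_at_right_less)

lemma pure_poly_sum:
  "(\<forall>i\<in>{1..N}. \<alpha> i \<ge> 0) \<Longrightarrow> pure_poly (\<lambda>t. \<Sum>i=1..(N::nat). a i * t powr \<alpha> i)"
  by (induction N) (auto simp: pure_poly_0 intro!: pure_poly_add pure_poly_monom)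

lemma pure_poly_imp_sum:
  "pure_poly f \<Longrightarrow> \<exists>(N::nat) a \<alpha>. (\<forall>i\<in>{1..N}. \<alpha> i \<ge> 0) \<and> f = (\<lambda>t. \<Sum>i=1..N. a i * t powr \<alpha> i)"
proof (induction rule: pure_poly.induct)
  case pure_poly_0
  show ?case by (rule exI[of _ 0]) auto
next
  case (pure_poly_step f s b)
  then obtain N :: nat and a \<alpha> where
    *: "\<forall>i\<in>{1..N}. \<alpha> i \<ge> 0" "f = (\<lambda>t. \<Sum>i=1..N. a i * t powr \<alpha> i)" by blast
  have "(\<forall>i\<in>{1..Suc N}. (\<alpha>(Suc N := s)) i \<ge> 0)"
    using * pure_poly_step by auto
  moreover have "(\<lambda>t. b * t powr s + f t) =
    (\<lambda>t. \<Sum>i=1..Suc N. (a(Suc N := b)) i * t powr (\<alpha>(Suc N := s)) i)"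
    by (auto simp: * fun_eq_iff intro!: sum.cong)
  ultimately show ?case by blast
qed

lemma little_oh_poly_iff:
  "little_oh_poly x \<longleftrightarrow> (\<exists>g. pure_poly g \<and> (\<lambda>t. x t - g t) \<in> o[at_right 0](\<lambda>t. t))"
proof
  assume "little_oh_poly x"
  then obtain N :: nat and r a \<alpha> where *: "\<forall>i\<in>{1..N}. \<alpha> i \<ge> 0"
     "(\<lambda>t. x t - (r + (\<Sum>i=1..N. a i * t powr \<alpha> i))) \<in> o[at_right 0](\<lambda>t. t)"
    unfolding little_oh_poly_def by blast
  have "pure_poly (\<lambda>t. r * t powr 0 + (\<Sum>i=1..N. a i * t powr \<alpha> i))"
    by (intro pure_poly_const_add pure_poly_sum *)
  moreover have "(\<lambda>t. x t - (r * t powr 0 + (\<Sum>i=1..N. a i * t powr \<alpha> i)))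
      \<in> o[at_right 0](\<lambda>t. t)"
  proof (rule landau_o.small.in_cong[THEN iffD2, OF _ *(2)])
    show "\<forall>\<^sub>F t in at_right 0. x t - (r * t powr 0 + (\<Sum>i=1..N. a i * t powr \<alpha> i)) =
      x t - (r + (\<Sum>i=1..N. a i * t powr \<alpha> i))"
      using ev_right_pos by eventually_elim auto
  qed
  ultimately show "\<exists>g. pure_poly g \<and> (\<lambda>t. x t - g t) \<in> o[at_right 0](\<lambda>t. t)"
    by (intro exI conjI)
next
  assume "\<exists>g. pure_poly g \<and> (\<lambda>t. x t - g t) \<in> o[at_right 0](\<lambda>t. t)"
  then obtain g where g: "pure_poly g" "(\<lambda>t. x t - g t) \<in> o[at_right 0](\<lambda>t. t)" by blast
  from pure_poly_imp_sum[OF g(1)] obtain N :: nat and a \<alpha> where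
    *: "\<forall>i\<in>{1..N}. \<alpha> i \<ge> 0" "g = (\<lambda>t. \<Sum>i=1..N. a i * t powr \<alpha> i)" by blast
  show "little_oh_poly x"
    unfolding little_oh_poly_def using * g(2)
    by (intro exI[of _ N] exI[of _ 0] exI[of _ a] exI[of _ \<alpha>]) auto
qed

lemma little_oh_poly_pure: "pure_poly f \<Longrightarrow> little_oh_poly f"
  unfolding little_oh_poly_iff by (rule exI[of _ f]) auto

lemma little_oh_poly_monom: "s \<ge> 0 \<Longrightarrow> little_oh_poly (\<lambda>t. t powr s)"
  using little_oh_poly_pure[OF pure_poly_monom[of s 1]] by simp

lemma little_oh_poly_cong:
  assumes "little_oh_poly f" "(\<lambda>t. g t - f t) \<in> o[at_right 0](\<lambda>t. t)"
  shows "little_oh_poly g"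
proof -
  from assms obtain h where h: "pure_poly h" "(\<lambda>t. f t - h t) \<in> o[at_right 0](\<lambda>t. t)"
    unfolding little_oh_poly_iff by blast
  from sum_in_smallo(1)[OF assms(2) h(2)] have "(\<lambda>t. g t - h t) \<in> o[at_right 0](\<lambda>t. t)" by simp
  with h show ?thesis unfolding little_oh_poly_iff by blast
qed

lemma little_oh_poly_const: "little_oh_poly (\<lambda>t. c)"
proof (rule little_oh_poly_cong)
  show "little_oh_poly (\<lambda>t. c * t powr 0)"
    by (intro little_oh_poly_pure pure_poly_monom) simp
  show "(\<lambda>t. c - c * t powr 0) \<in> o[at_right 0](\<lambda>t. t)"
  proof (rule landau_o.small.in_cong[THEN iffD2])
    show "\<forall>\<^sub>F t in at_right 0. c - c * t powr 0 = 0"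
      using ev_right_pos by eventually_elim auto
  qed simp
qed

lemma little_oh_poly_add:
  assumes "little_oh_poly f" "little_oh_poly g"
  shows "little_oh_poly (\<lambda>t. f t + g t)"
proof -
  from assms obtain f' g' where
    *: "pure_poly f'" "(\<lambda>t. f t - f' t) \<in> o[at_right 0](\<lambda>t. t)"
       "pure_poly g'" "(\<lambda>t. g t - g' t) \<in> o[at_right 0](\<lambda>t. t)"
    unfolding little_oh_poly_iff by blast
  from sum_in_smallo(1)[OF *(2) *(4)]
  have "(\<lambda>t. (f t + g t) - (f' t + g' t)) \<in> o[at_right 0](\<lambda>t. t)" by (simp add: algebra_simps)
  with pure_poly_add[OF *(1,3)] show ?thesis unfolding little_oh_poly_iff by blast
qed

lemma pure_poly_bigo: "pure_poly f \<Longrightarrow> f \<in> O[at_right 0](\<lambda>_. 1)"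
proof (induction rule: pure_poly.induct)
  case (pure_poly_step f s a)
  have "(\<lambda>t. a * t powr s) \<in> O[at_right 0](\<lambda>_. 1)"
  proof (rule bigoI[of _ "\<bar>a\<bar>"])
    have "eventually (\<lambda>t::real. t < 1) (at_right 0)"
      by (rule eventually_at_rightI[of 0 1]) auto
    with ev_right_pos show "\<forall>\<^sub>F t in at_right 0. norm (a * t powr s) \<le> \<bar>a\<bar> * norm (1::real)"
    proof eventually_elim
      case (elim t)
      have "t powr s \<le> 1" using elim pure_poly_step by (intro powr_le1) auto
      thus ?case by (simp add: abs_mult mult_left_le)
    qed
  qed
  with pure_poly_step.IH show ?case by (intro sum_in_bigo)
qed simp

lemma little_oh_poly_bigo:
  assumes "little_oh_poly f"
  shows "f \<in> O[at_right 0](\<lambda>_. 1)"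
proof -
  from assms obtain g where g: "pure_poly g" "(\<lambda>t. f t - g t) \<in> o[at_right 0](\<lambda>t. t)"
    unfolding little_oh_poly_iff by blast
  have "(\<lambda>t::real. t) \<in> O[at_right 0](\<lambda>_. 1)"
    by (rule bigoI[of _ 1], rule eventually_at_rightI[of 0 1]) auto
  with g(2) have "(\<lambda>t. f t - g t) \<in> O[at_right 0](\<lambda>_. 1)"
    by (meson landau_o.big_trans landau_o.small_imp_big)
  from sum_in_bigo(1)[OF this pure_poly_bigo[OF g(1)]] show ?thesis by simp
qed

lemma smallo_mult_poly:
  assumes "little_oh_poly f" "g \<in> o[at_right 0](\<lambda>t. t)"
  shows "(\<lambda>t. f t * g t) \<in> o[at_right 0](\<lambda>t. t)"
  using landau_o.big_small_mult[OF little_oh_poly_bigo[OF assms(1)] assms(2)] by simp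

lemma smallo_mult_diff:
  assumes "little_oh_poly f" "little_oh_poly g'"
    "(\<lambda>t. f t - f' t) \<in> o[at_right 0](\<lambda>t. t)" "(\<lambda>t. g t - g' t) \<in> o[at_right 0](\<lambda>t. t)"
  shows "(\<lambda>t. f t * g t - f' t * g' t) \<in> o[at_right 0](\<lambda>t. t)"
  using sum_in_smallo(1)[OF smallo_mult_poly[OF assms(1,4)] smallo_mult_poly[OF assms(2,3)]]
  by (simp add: algebra_simps)

lemma little_oh_poly_mult:
  assumes "little_oh_poly f" "little_oh_poly g"
  shows "little_oh_poly (\<lambda>t. f t * g t)"
proof -
  from assms obtain f' g' where
    *: "pure_poly f'" "(\<lambda>t. f t - f' t) \<in> o[at_right 0](\<lambda>t. t)"
       "pure_poly g'" "(\<lambda>t. g t - g' t) \<in> o[at_right 0](\<lambda>t. t)"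
    unfolding little_oh_poly_iff by blast
  show ?thesis unfolding little_oh_poly_iff
    using smallo_mult_diff[OF assms(1) little_oh_poly_pure[OF *(3)] *(2,4)]
      pure_poly_mult[OF *(1,3)] by blast
qed

lemma little_oh_poly_cmult: "little_oh_poly f \<Longrightarrow> little_oh_poly (\<lambda>t. c * f t)"
  using little_oh_poly_mult[OF little_oh_poly_const] .

lemma little_oh_poly_uminus: "little_oh_poly f \<Longrightarrow> little_oh_poly (\<lambda>t. - f t)"
  using little_oh_poly_cmult[of f "-1"] by simp


section \<open>The ring of Fermat reals\<close>

lemma part_equivp_fermat_rel: "part_equivp fermat_rel"
proof (rule part_equivpI)
  show "\<exists>x. fermat_rel x x"
    by (rule exI[of _ "\<lambda>_. 0"]) (simp add: fermat_rel_def little_oh_poly_const)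
  show "symp fermat_rel"
  proof (rule sympI)
    fix x y assume "fermat_rel x y"
    thus "fermat_rel y x"
      using landau_o.small.uminus_in_iff[of "\<lambda>t. x t - y t" "at_right 0" "\<lambda>t. t"]
      by (simp add: fermat_rel_def)
  qed
  show "transp fermat_rel"
  proof (rule transpI)
    fix x y z assume "fermat_rel x y" "fermat_rel y z"
    thus "fermat_rel x z"
      using sum_in_smallo(1)[of "\<lambda>t. x t - y t" "at_right 0" "\<lambda>t. t" "\<lambda>t. y t - z t"]
      by (simp add: fermat_rel_def)
  qed
qed

quotient_type fermat = "real \<Rightarrow> real" / partial: fermat_rel
  by (rule part_equivp_fermat_rel)

instantiation fermat :: "{comm_ring_1, real_algebra_1}"
begin

lift_definition zero_fermat :: fermat is "\<lambda>_. 0"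
  by (simp add: fermat_rel_def little_oh_poly_const)

lift_definition one_fermat :: fermat is "\<lambda>_. 1"
  by (simp add: fermat_rel_def little_oh_poly_const)

lift_definition plus_fermat :: "fermat \<Rightarrow> fermat \<Rightarrow> fermat" is "\<lambda>x y t. x t + y t"
  subgoal for x x' y y'
    using sum_in_smallo(1)[of "\<lambda>t. x t - x' t" "at_right 0" "\<lambda>t. t" "\<lambda>t. y t - y' t"]
    by (simp add: fermat_rel_def little_oh_poly_add algebra_simps)
  done

lift_definition uminus_fermat :: "fermat \<Rightarrow> fermat" is "\<lambda>x t. - x t"
  subgoal for x x'
    using landau_o.small.uminus_in_iff[of "\<lambda>t. x t - x' t" "at_right 0" "\<lambda>t. t"]
    by (simp add: fermat_rel_def little_oh_poly_uminus)
  done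

definition minus_fermat :: "fermat \<Rightarrow> fermat \<Rightarrow> fermat" where
  "x - y = x + (- y)" for x y :: fermat

lift_definition times_fermat :: "fermat \<Rightarrow> fermat \<Rightarrow> fermat" is "\<lambda>x y t. x t * y t"
  by (simp add: fermat_rel_def little_oh_poly_mult smallo_mult_diff)

lift_definition scaleR_fermat :: "real \<Rightarrow> fermat \<Rightarrow> fermat" is "\<lambda>c x t. c * x t"
  subgoal for c x x'
    using smallo_mult_poly[OF little_oh_poly_const[of c], of "\<lambda>t. x t - x' t"]
    by (simp add: fermat_rel_def little_oh_poly_cmult right_diff_distrib)
  done

lemma fermat_relI: "little_oh_poly x \<Longrightarrow> x = y \<Longrightarrow> fermat_rel x y"
  by (simp add: fermat_rel_def)

lemma fermat_rel_poly: "fermat_rel x x \<Longrightarrow> little_oh_poly x"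
  by (simp add: fermat_rel_def)

lemma one_not_smallo: "(\<lambda>_. 1::real) \<notin> o[at_right 0](\<lambda>t::real. t)"
proof
  assume "(\<lambda>_. 1::real) \<in> o[at_right 0](\<lambda>t::real. t)"
  from landau_o.smallD[OF this, of 1]
  have "eventually (\<lambda>t::real. 1 \<le> t) (at_right 0)"
    using ev_right_pos by (auto elim: eventually_elim2)
  moreover have "eventually (\<lambda>t::real. t < 1) (at_right 0)"
    by (rule eventually_at_rightI[of 0 1]) auto
  ultimately have "eventually (\<lambda>t::real. False) (at_right 0)" by eventually_elim auto
  thus False by simp
qed

instance
proof
  fix x y z :: fermat and a b :: real
  note [intro!] = little_oh_poly_add little_oh_poly_mult little_oh_poly_cmult
    little_oh_poly_uminus little_oh_poly_const
  show "x + y + z = x + (y + z)"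
    by transfer (auto intro!: fermat_relI dest!: fermat_rel_poly)
  show "x + y = y + x"
    by transfer (auto intro!: fermat_relI dest!: fermat_rel_poly)
  show "0 + x = x"
    by transfer (auto intro!: fermat_relI dest!: fermat_rel_poly)
  show "- x + x = 0"
    by transfer (auto intro!: fermat_relI dest!: fermat_rel_poly)
  show "x - y = x + - y"
    by (rule minus_fermat_def)
  show "x * y * z = x * (y * z)"
    by transfer (auto intro!: fermat_relI dest!: fermat_rel_poly)
  show "x * y = y * x"
    by transfer (auto intro!: fermat_relI dest!: fermat_rel_poly)
  show "x * (y + z) = x * y + x * z"
    by transfer (auto intro!: fermat_relI dest!: fermat_rel_poly simp: algebra_simps)
  show "x * 1 = x"
    by transfer (auto intro!: fermat_relI dest!: fermat_rel_poly)
  show "1 * x = x"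
    by transfer (auto intro!: fermat_relI dest!: fermat_rel_poly)
  show "(x + y) * z = x * z + y * z"
    by transfer (auto intro!: fermat_relI dest!: fermat_rel_poly simp: algebra_simps)
  show "(0::fermat) \<noteq> 1"
  proof transfer
    show "\<not> fermat_rel (\<lambda>_. 0) (\<lambda>_. 1)"
      using one_not_smallo landau_o.small.uminus_in_iff[of "\<lambda>_. 1" "at_right 0" "\<lambda>t. t"]
      by (simp add: fermat_rel_def)
  qed
  show "a *\<^sub>R (x + y) = a *\<^sub>R x + a *\<^sub>R y"
    by transfer (auto intro!: fermat_relI dest!: fermat_rel_poly simp: algebra_simps)
  show "(a + b) *\<^sub>R x = a *\<^sub>R x + b *\<^sub>R x"
    by transfer (auto intro!: fermat_relI dest!: fermat_rel_poly simp: algebra_simps)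
  show "a *\<^sub>R b *\<^sub>R x = (a * b) *\<^sub>R x"
    by transfer (auto intro!: fermat_relI dest!: fermat_rel_poly simp: algebra_simps)
  show "1 *\<^sub>R x = x"
    by transfer (auto intro!: fermat_relI dest!: fermat_rel_poly)
  show "a *\<^sub>R x * y = a *\<^sub>R (x * y)"
    by transfer (auto intro!: fermat_relI dest!: fermat_rel_poly)
  show "x * a *\<^sub>R y = a *\<^sub>R (x * y)"
    by transfer (auto intro!: fermat_relI dest!: fermat_rel_poly)
qed

end

lemma abs_fermat_eq_iff:
  assumes "little_oh_poly f" "little_oh_poly g"
  shows "abs_fermat f = abs_fermat g \<longleftrightarrow> (\<lambda>t. f t - g t) \<in> o[at_right 0](\<lambda>t. t)"
proof -
  have "fermat_rel f f" "fermat_rel g g" using assms by (auto simp: fermat_rel_def)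
  with Quotient3_rel[OF Quotient3_fermat, of f g] assms show ?thesis
    by (auto simp: fermat_rel_def)
qed

lemma fermat_relI': "little_oh_poly f \<Longrightarrow> fermat_rel f f"
  by (simp add: fermat_rel_def)

lemma abs_fermat_add:
  "little_oh_poly f \<Longrightarrow> little_oh_poly g \<Longrightarrow>
     abs_fermat f + abs_fermat g = abs_fermat (\<lambda>t. f t + g t)"
  by (intro plus_fermat.abs_eq fermat_relI')

lemma abs_fermat_mult:
  "little_oh_poly f \<Longrightarrow> little_oh_poly g \<Longrightarrow>
     abs_fermat f * abs_fermat g = abs_fermat (\<lambda>t. f t * g t)"
  by (intro times_fermat.abs_eq fermat_relI')

lemma abs_fermat_scaleR:
  "little_oh_poly f \<Longrightarrow> c *\<^sub>R abs_fermat f = abs_fermat (\<lambda>t. c * f t)"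
  by (intro scaleR_fermat.abs_eq fermat_relI')

lemma of_real_fermat: "of_real r = abs_fermat (\<lambda>_. r)"
  by (simp add: of_real_def one_fermat_def abs_fermat_scaleR little_oh_poly_const)

lemma abs_rep_fermat: "abs_fermat (rep_fermat x) = x"
  by (rule Quotient3_abs_rep[OF Quotient3_fermat])

lemma little_oh_poly_rep: "little_oh_poly (rep_fermat x)"
  using Quotient3_rep_reflp[OF Quotient3_fermat, of x] by (rule fermat_rel_poly)


section \<open>Decomposition, order and standard parts\<close>

text \<open>For \<open>a \<le> 0\<close>, where the notation is not used, \<open>dt a\<close> is \<open>0\<close> by convention.\<close>

lift_definition dt :: "real \<Rightarrow> fermat" is "\<lambda>a t. if a > 0 then t powr (1 / a) else 0"
  subgoal for a
    by (cases "a > 0") (simp_all add: fermat_rel_def little_oh_poly_const little_oh_poly_monom)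
  done

text \<open>The list \<open>ps\<close> consists of the pairs of coefficients and orders of the infinitesimal terms.\<close>

definition is_decomposition :: "fermat \<Rightarrow> real \<Rightarrow> (real \<times> real) list \<Rightarrow> bool" where
  "is_decomposition x r ps \<longleftrightarrow>
     x = of_real r + (\<Sum>(a, w)\<leftarrow>ps. a *\<^sub>R dt w) \<and>
     sorted_wrt (>) (map snd ps) \<and> (\<forall>(a, w)\<in>set ps. a \<noteq> 0 \<and> w \<ge> 1)"

lemma tendsto_powr_right: "s > 0 \<Longrightarrow> ((\<lambda>t::real. t powr s) \<longlongrightarrow> 0) (at_right 0)"
  by (rule tendsto_eq_intros | simp | rule eventually_mono[OF ev_right_pos])+

lemma powers_independent:
  fixes T :: "real set" and a :: "real \<Rightarrow> real"
  assumes "finite T"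
  shows "T \<subseteq> {0..1} \<Longrightarrow> (\<lambda>t. \<Sum>s\<in>T. a s * t powr s) \<in> o[at_right 0](\<lambda>t. t) \<Longrightarrow>
    \<forall>s\<in>T. a s = 0"
  using assms
proof (induction rule: finite_linorder_min_induct)
  case (insert b A)
  let ?f = "\<lambda>t. \<Sum>s\<in>insert b A. a s * t powr s"
  have [simp]: "b \<notin> A" using insert by auto
  have b: "0 \<le> b" "b \<le> 1" using insert by auto
  have "((\<lambda>t. ?f t / t) \<longlongrightarrow> 0) (at_right 0)"
    by (rule smalloD_tendsto[OF insert.prems(2)])
  moreover have "\<exists>l. ((\<lambda>t::real. t powr (1 - b)) \<longlongrightarrow> l) (at_right 0)"
  proof (cases "b = 1")
    case True
    have "((\<lambda>t::real. t powr (1 - b)) \<longlongrightarrow> 1) (at_right 0)"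
      by (rule tendsto_eventually) (use ev_right_pos True in \<open>auto elim: eventually_mono\<close>)
    thus ?thesis ..
  qed (use b tendsto_powr_right[of "1 - b"] in auto)
  then obtain l where "((\<lambda>t::real. t powr (1 - b)) \<longlongrightarrow> l) (at_right 0)" ..
  ultimately have "((\<lambda>t. ?f t / t * t powr (1 - b)) \<longlongrightarrow> 0 * l) (at_right 0)"
    by (rule tendsto_mult)
  moreover have "eventually (\<lambda>t. ?f t / t * t powr (1 - b) =
     a b + (\<Sum>s\<in>A. a s * t powr (s - b))) (at_right 0)"
    using ev_right_pos
  proof eventually_elim
    case (elim t)
    have "?f t / t * t powr (1 - b) = ?f t * t powr (-b)"
      using elim by (simp add: powr_diff powr_minus field_simps)
    also have "\<dots> = a b * (t powr b * t powr (-b)) + (\<Sum>s\<in>A. a s * (t powr s * t powr (-b)))"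
      using insert by (simp add: algebra_simps sum_distrib_left)
    also have "\<dots> = a b + (\<Sum>s\<in>A. a s * t powr (s - b))"
      using elim by (simp add: powr_add[symmetric])
    finally show ?case .
  qed
  ultimately have "((\<lambda>t. a b + (\<Sum>s\<in>A. a s * t powr (s - b))) \<longlongrightarrow> 0) (at_right 0)"
    by (simp cong: filterlim_cong)
  moreover have "((\<lambda>t. a b + (\<Sum>s\<in>A. a s * t powr (s - b))) \<longlongrightarrow> a b + (\<Sum>s\<in>A. a s * 0))
      (at_right 0)"
    using insert by (intro tendsto_intros tendsto_powr_right) auto
  ultimately have "a b = 0"
    using tendsto_unique[of "at_right (0::real)"] by fastforce
  with insert show ?case by auto
qed simp

lemma sum_dt_eq:
  assumes "finite W" "W \<subseteq> {1..}"
  shows "of_real r + (\<Sum>w\<in>W. c w *\<^sub>R dt w) = abs_fermat (\<lambda>t. r + (\<Sum>w\<in>W. c w * t powr (1 / w)))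
     \<and> little_oh_poly (\<lambda>t. r + (\<Sum>w\<in>W. c w * t powr (1 / w)))"
  using assms
proof (induction W rule: finite_induct)
  case (insert v W)
  have v: "v \<ge> 1" and dt: "dt v = abs_fermat (\<lambda>t. t powr (1 / v))"
    using insert by (auto simp: dt_def)
  have poly: "little_oh_poly (\<lambda>t. t powr (1 / v))" using v by (intro little_oh_poly_monom) auto
  let ?f = "\<lambda>t. r + (\<Sum>w\<in>W. c w * t powr (1 / w))"
  have IH: "of_real r + (\<Sum>w\<in>W. c w *\<^sub>R dt w) = abs_fermat ?f" "little_oh_poly ?f"
    using insert by auto
  have "of_real r + (\<Sum>w\<in>insert v W. c w *\<^sub>R dt w) =
      (of_real r + (\<Sum>w\<in>W. c w *\<^sub>R dt w)) + c v *\<^sub>R dt v"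
    using insert by (simp add: algebra_simps)
  also have "\<dots> = abs_fermat (\<lambda>t. ?f t + c v * t powr (1 / v))"
    unfolding IH(1) dt using poly IH(2)
    by (simp add: abs_fermat_add abs_fermat_scaleR little_oh_poly_cmult)
  finally show ?case
    using insert little_oh_poly_add[OF IH(2) little_oh_poly_cmult[OF poly, of "c v"]]
    by (simp add: algebra_simps)
qed (simp add: of_real_fermat little_oh_poly_const)

lemma dt_independent:
  assumes "finite W" "W \<subseteq> {1..}" "of_real r + (\<Sum>w\<in>W. c w *\<^sub>R dt w) = 0"
  shows "r = 0 \<and> (\<forall>w\<in>W. c w = 0)"
proof -
  have "(\<lambda>t. r + (\<Sum>w\<in>W. c w * t powr (1 / w))) \<in> o[at_right 0](\<lambda>t. t)"
    using sum_dt_eq[OF assms(1,2), of r c] assms(3)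
      abs_fermat_eq_iff[of "\<lambda>t. r + (\<Sum>w\<in>W. c w * t powr (1 / w))" "\<lambda>_. 0"]
    by (auto simp: zero_fermat_def little_oh_poly_const)
  define a where "a s = (if s = 0 then r else c (1 / s))" for s
  let ?T = "insert 0 ((\<lambda>w. 1 / w) ` W)"
  have inj: "inj_on (\<lambda>w. 1 / w) W" by (auto simp: inj_on_def)
  have "0 \<notin> (\<lambda>w. 1 / w) ` W" using assms(2) by auto
  hence sum: "(\<Sum>s\<in>?T. a s * t powr s) = r * t powr 0 + (\<Sum>w\<in>W. c w * t powr (1 / w))" for t
    using assms(1,2) by (auto simp: sum.reindex[OF inj] a_def intro!: sum.cong)
  have "(\<lambda>t. \<Sum>s\<in>?T. a s * t powr s) \<in> o[at_right 0](\<lambda>t. t)"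
  proof (rule landau_o.small.in_cong[THEN iffD2])
    show "\<forall>\<^sub>F t in at_right 0. (\<Sum>s\<in>?T. a s * t powr s) = r + (\<Sum>w\<in>W. c w * t powr (1 / w))"
      unfolding sum using ev_right_pos by eventually_elim auto
  qed fact
  hence *: "\<forall>s\<in>?T. a s = 0"
    using assms(1,2) by (intro powers_independent) auto
  have "c w = 0" if "w \<in> W" for w
  proof -
    from that assms(2) have "w \<noteq> 0" by auto
    moreover have "a (1 / w) = 0" using * that by blast
    ultimately show ?thesis by (simp add: a_def)
  qed
  with * show ?thesis by (auto simp: a_def)
qed

lemma fermat_eq_sum_dt:
  "\<exists>r W c. finite W \<and> W \<subseteq> {1..} \<and> x = of_real r + (\<Sum>w\<in>W. c w *\<^sub>R dt w)"
proof -
  from little_oh_poly_rep[of x] obtain g where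
    g: "pure_poly g" "(\<lambda>t. rep_fermat x t - g t) \<in> o[at_right 0](\<lambda>t. t)"
    unfolding little_oh_poly_iff by blast
  hence x: "x = abs_fermat g"
    using abs_fermat_eq_iff[OF little_oh_poly_rep little_oh_poly_pure, of g x]
    by (simp add: abs_rep_fermat)
  from g(1) have "\<exists>r W c. finite W \<and> W \<subseteq> {1..} \<and>
      abs_fermat g = of_real r + (\<Sum>w\<in>W. c w *\<^sub>R dt w)"
  proof (induction rule: pure_poly.induct)
    case pure_poly_0
    show ?case by (rule exI[of _ 0], rule exI[of _ "{}"]) (simp add: zero_fermat_def)
  next
    case (pure_poly_step f s a)
    from pure_poly_step.IH obtain r W c where
      IH: "finite W" "W \<subseteq> {1..}" "abs_fermat f = of_real r + (\<Sum>w\<in>W. c w *\<^sub>R dt w)" by blast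
    let ?m = "abs_fermat (\<lambda>t. t powr s)"
    note poly = little_oh_poly_monom[OF pure_poly_step.hyps(2)]
    have eq: "abs_fermat (\<lambda>t. a * t powr s + f t) = a *\<^sub>R ?m + abs_fermat f"
      using poly little_oh_poly_pure[OF pure_poly_step.hyps(1)]
      by (simp add: abs_fermat_add abs_fermat_scaleR little_oh_poly_cmult)
    consider "s = 0" | "0 < s" "s \<le> 1" | "s > 1" using pure_poly_step by linarith
    thus ?case
    proof cases
      case 1
      have "(\<lambda>t::real. t powr s - 1) \<in> o[at_right 0](\<lambda>t. t)"
      proof (rule landau_o.small.in_cong[THEN iffD2])
        show "\<forall>\<^sub>F t::real in at_right 0. t powr s - 1 = 0"
          using ev_right_pos by eventually_elim (use 1 in auto)
      qed simp
      hence "?m = 1"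
        using abs_fermat_eq_iff[OF poly little_oh_poly_const[of 1]] by (simp add: one_fermat_def)
      hence "abs_fermat (\<lambda>t. a * t powr s + f t) = of_real (a + r) + (\<Sum>w\<in>W. c w *\<^sub>R dt w)"
        unfolding eq IH(3) by (simp add: of_real_def algebra_simps)
      with IH show ?thesis by blast
    next
      case 3
      have "(\<lambda>t::real. t powr s - 0) \<in> o[at_right 0](\<lambda>t. t)"
      proof (rule smalloI_tendsto)
        have "((\<lambda>t::real. t powr (s - 1)) \<longlongrightarrow> 0) (at_right 0)"
          using 3 by (intro tendsto_powr_right) simp
        moreover have "\<forall>\<^sub>F t::real in at_right 0. t powr (s - 1) = (t powr s - 0) / t"
          using ev_right_pos by eventually_elim (simp add: powr_diff)
        ultimately show "((\<lambda>t::real. (t powr s - 0) / t) \<longlongrightarrow> 0) (at_right 0)"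
          by (rule Lim_transform_eventually)
        show "\<forall>\<^sub>F t::real in at_right 0. t \<noteq> 0"
          using ev_right_pos by eventually_elim auto
      qed
      hence "?m = 0"
        using abs_fermat_eq_iff[OF poly little_oh_poly_const[of 0]] by (simp add: zero_fermat_def)
      with IH eq show ?thesis by auto
    next
      case 2
      define v where "v = 1 / s"
      have v: "v \<ge> 1" using 2 by (simp add: v_def)
      have m: "?m = dt v" using 2 by (simp add: dt_def v_def)
      define c' where "c' w = (if w = v then a else 0) + (if w \<in> W then c w else 0)" for w
      have "(\<Sum>w\<in>insert v W. c' w *\<^sub>R dt w) =
         (\<Sum>w\<in>insert v W. (if w = v then a *\<^sub>R dt w else 0)) +
         (\<Sum>w\<in>insert v W. (if w \<in> W then c w *\<^sub>R dt w else 0))"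
        unfolding sum.distrib[symmetric]
        by (intro sum.cong) (auto simp: c'_def scaleR_add_left)
      also have "(\<Sum>w\<in>insert v W. (if w = v then a *\<^sub>R dt w else 0)) = a *\<^sub>R dt v"
        using IH(1) by (subst sum.delta) auto
      also have "(\<Sum>w\<in>insert v W. (if w \<in> W then c w *\<^sub>R dt w else 0)) = (\<Sum>w\<in>W. c w *\<^sub>R dt w)"
        using IH(1) by (intro sum.mono_neutral_cong_right) auto
      finally have "abs_fermat (\<lambda>t. a * t powr s + f t) =
          of_real r + (\<Sum>w\<in>insert v W. c' w *\<^sub>R dt w)"
        unfolding eq IH(3) m by simp
      with IH v show ?thesis
        by (intro exI[of _ r] exI[of _ "insert v W"] exI[of _ c']) auto
    qed
  qed
  thus ?thesis by (simp add: x)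
qed

theorem ex1_decomposition: "\<exists>!d. is_decomposition x (fst d) (snd d)"
proof (rule ex_ex1I)
  obtain r W c where W: "finite W" "W \<subseteq> {1..}" "x = of_real r + (\<Sum>w\<in>W. c w *\<^sub>R dt w)"
    using fermat_eq_sum_dt[of x] by blast
  define V where "V = {w \<in> W. c w \<noteq> 0}"
  have V: "finite V" "V \<subseteq> {1..}" using W by (auto simp: V_def)
  have "(\<Sum>w\<in>W. c w *\<^sub>R dt w) = (\<Sum>w\<in>V. c w *\<^sub>R dt w)"
    using W by (intro sum.mono_neutral_right) (auto simp: V_def)
  define ps where "ps = map (\<lambda>w. (c w, w)) (rev (sorted_list_of_set V))"
  have "(\<Sum>(a, w)\<leftarrow>ps. a *\<^sub>R dt w) = (\<Sum>w\<leftarrow>rev (sorted_list_of_set V). c w *\<^sub>R dt w)"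
    by (simp add: ps_def o_def)
  also have "\<dots> = (\<Sum>w\<in>V. c w *\<^sub>R dt w)"
    using V(1) by (subst sum_list_distinct_conv_sum_set) auto
  finally have "x = of_real r + (\<Sum>(a, w)\<leftarrow>ps. a *\<^sub>R dt w)"
    using W(3) \<open>(\<Sum>w\<in>W. c w *\<^sub>R dt w) = _\<close> by simp
  moreover have "map snd ps = rev (sorted_list_of_set V)"
    by (simp add: ps_def o_def)
  moreover have "\<forall>(a, w)\<in>set ps. a \<noteq> 0 \<and> w \<ge> 1"
    using V by (auto simp: ps_def V_def)
  ultimately have "is_decomposition x r ps"
    by (simp add: is_decomposition_def sorted_wrt_rev)
  thus "\<exists>d. is_decomposition x (fst d) (snd d)" by (intro exI[of _ "(r, ps)"]) simp
next
  define cf where "cf ps w = (\<Sum>(a, v)\<leftarrow>ps. if v = w then a else (0::real))"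
    for ps :: "(real \<times> real) list" and w
  have cf_sum: "(\<Sum>(a, w)\<leftarrow>ps. a *\<^sub>R dt w) = (\<Sum>w\<in>W. cf ps w *\<^sub>R dt w)"
    if "finite W" "snd ` set ps \<subseteq> W" for ps W
    using that(2)
  proof (induction ps)
    case (Cons p ps)
    obtain a v where p: "p = (a, v)" by fastforce
    have "(\<Sum>w\<in>W. cf (p # ps) w *\<^sub>R dt w) =
       (\<Sum>w\<in>W. (if w = v then a *\<^sub>R dt w else 0)) + (\<Sum>w\<in>W. cf ps w *\<^sub>R dt w)"
      unfolding sum.distrib[symmetric]
      by (intro sum.cong) (auto simp: cf_def p scaleR_add_left)
    also have "(\<Sum>w\<in>W. (if w = v then a *\<^sub>R dt w else 0)) = a *\<^sub>R dt v"
      using that(1) Cons.prems by (subst sum.delta) (auto simp: p)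
    finally show ?case using Cons by (simp add: p)
  qed (simp add: cf_def)
  have cf_notin: "cf ps w = 0" if "w \<notin> snd ` set ps" for ps w
    using that by (induction ps) (auto simp: cf_def)
  have cf_in: "cf ps w = a" if "(a, w) \<in> set ps" "distinct (map snd ps)" for ps a w
    using that
  proof (induction ps)
    case (Cons p ps)
    show ?case
    proof (cases "p = (a, w)")
      case True
      with Cons.prems cf_notin[of w ps] show ?thesis by (force simp: cf_def)
    next
      case False
      with Cons.prems have "(a, w) \<in> set ps" by simp
      hence "w \<in> snd ` set ps" by (rule image_eqI[rotated]) simp
      with Cons.prems have "snd p \<noteq> w" by auto
      with Cons \<open>(a, w) \<in> set ps\<close> show ?thesis by (cases p) (simp add: cf_def)
    qed
  qed simp
  have dist: "distinct (map snd ps)" if "is_decomposition x r ps" for r ps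
  proof -
    have "sorted_wrt (<) (rev (map snd ps))"
      using that by (simp add: is_decomposition_def sorted_wrt_rev)
    hence "distinct (rev (map snd ps))" by (simp only: strict_sorted_iff)
    thus ?thesis by simp
  qed
  fix d e
  assume d: "is_decomposition x (fst d) (snd d)" and e: "is_decomposition x (fst e) (snd e)"
  define W where "W = snd ` set (snd d) \<union> snd ` set (snd e)"
  have W: "finite W" "W \<subseteq> {1..}" using d e by (auto simp: W_def is_decomposition_def)
  have "of_real (fst d) + (\<Sum>w\<in>W. cf (snd d) w *\<^sub>R dt w) = x"
       "of_real (fst e) + (\<Sum>w\<in>W. cf (snd e) w *\<^sub>R dt w) = x"
    using d e cf_sum[OF W(1), of "snd d"] cf_sum[OF W(1), of "snd e"]
    by (auto simp: is_decomposition_def W_def)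
  hence "of_real (fst d - fst e) + (\<Sum>w\<in>W. (cf (snd d) w - cf (snd e) w) *\<^sub>R dt w) = 0"
    by (simp add: scaleR_diff_left sum_subtractf algebra_simps)
  from dt_independent[OF W this]
  have fst: "fst d = fst e" and on_W: "\<And>w. w \<in> W \<Longrightarrow> cf (snd d) w = cf (snd e) w" by auto
  have cf: "cf (snd d) = cf (snd e)"
  proof (intro ext)
    fix w
    show "cf (snd d) w = cf (snd e) w"
    proof (cases "w \<in> W")
      case False
      hence "w \<notin> snd ` set (snd d)" "w \<notin> snd ` set (snd e)" by (auto simp: W_def)
      thus ?thesis using cf_notin[of w "snd d"] cf_notin[of w "snd e"] by argo
    qed (rule on_W)
  qed
  have set: "set (map snd (snd e)) = {w. cf (snd e) w \<noteq> 0}"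
    if "is_decomposition x (fst e) (snd e)" for e
  proof (intro equalityI subsetI)
    fix w assume "w \<in> set (map snd (snd e))"
    then obtain a where "(a, w) \<in> set (snd e)" by auto
    with that cf_in[OF this dist[OF that]] show "w \<in> {w. cf (snd e) w \<noteq> 0}"
      by (auto simp: is_decomposition_def)
  qed (use cf_notin in auto)
  have "rev (map snd (snd d)) = rev (map snd (snd e))"
    by (rule strict_sorted_equal)
      (use d e set[OF d] set[OF e] cf in \<open>auto simp: is_decomposition_def sorted_wrt_rev\<close>)
  hence snds: "map snd (snd d) = map snd (snd e)" by simp
  have recover: "snd e = map (\<lambda>w. (cf (snd e) w, w)) (map snd (snd e))"
    if "is_decomposition x (fst e) (snd e)" for e
    using cf_in[OF _ dist[OF that]] by (auto simp: o_def intro!: map_idI[symmetric])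
  have "snd d = snd e"
    using recover[OF d] recover[OF e] snds cf by metis
  with fst show "d = e" by (simp add: prod_eq_iff)
qed

definition decomposition :: "fermat \<Rightarrow> real \<times> (real \<times> real) list" where
  "decomposition x = (THE d. is_decomposition x (fst d) (snd d))"

definition std_part :: "fermat \<Rightarrow> real" where
  "std_part x = fst (decomposition x)"

definition num_terms :: "fermat \<Rightarrow> nat" where
  "num_terms x = length (snd (decomposition x))"

text \<open>The indices of the terms of the decomposition start at \<open>1\<close>.\<close>

definition std_coeff :: "fermat \<Rightarrow> nat \<Rightarrow> real" where
  "std_coeff x i = (if i \<in> {1..num_terms x} then fst (snd (decomposition x) ! (i - 1)) else 0)"

definition ord_term :: "fermat \<Rightarrow> nat \<Rightarrow> real" where
  "ord_term x i = (if i \<in> {1..num_terms x} then snd (snd (decomposition x) ! (i - 1)) else 0)"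

definition fermat_order :: "fermat \<Rightarrow> real" where
  "fermat_order x = ord_term x 1"

definition D_inf :: "fermat set" where
  "D_inf = {x. std_part x = 0}"

definition fermat_pos :: "fermat \<Rightarrow> bool" where
  "fermat_pos x \<longleftrightarrow> std_part x > 0 \<or> (std_part x = 0 \<and> x \<noteq> 0 \<and> std_coeff x 1 > 0)"

instantiation fermat :: ord
begin

definition less_fermat :: "fermat \<Rightarrow> fermat \<Rightarrow> bool" where
  "x < y \<longleftrightarrow> fermat_pos (y - x)"

definition less_eq_fermat :: "fermat \<Rightarrow> fermat \<Rightarrow> bool" where
  "x \<le> y \<longleftrightarrow> x < y \<or> x = y" for x y :: fermat

instance ..

end

definition eq_upto :: "real \<Rightarrow> fermat \<Rightarrow> fermat \<Rightarrow> bool" where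
  "eq_upto k x y \<longleftrightarrow> std_part x = std_part y \<and> fermat_order (x - y) \<le> k"


section \<open>Powers\<close>

text \<open>On \<^typ>\<open>ereal\<close> we have \<open>inverse \<infinity> = 0\<close> and \<open>inverse 0 = \<infinity>\<close>.\<close>

definition ominus :: "ereal \<Rightarrow> ereal \<Rightarrow> ereal" (infixl \<open>\<ominus>\<^sub>F\<close> 65) where
  "a \<ominus>\<^sub>F b = inverse (inverse a - inverse b)"

text \<open>
  The power of a Fermat real with positive standard part. The choice of the representative is
  irrelevant, see \<open>unit_powr_abs\<close> below.
\<close>

definition unit_powr :: "fermat \<Rightarrow> real \<Rightarrow> fermat" where
  "unit_powr y p = abs_fermat (\<lambda>t. rep_fermat y t powr p)"

text \<open>
  The power of a positive infinitesimal. In the sum, \<open>ord_term c i < fermat_order c\<close> for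
  all \<open>i\<close>, so that the order of each term is finite.
\<close>

definition inf_powr :: "fermat \<Rightarrow> real \<Rightarrow> fermat" where
  "inf_powr c p =
     (std_coeff c 1 powr p) *\<^sub>R dt (fermat_order c / p) *
     unit_powr (1 + (\<Sum>i=2..num_terms c. (std_coeff c i / std_coeff c 1) *\<^sub>R
       dt (real_of_ereal (ereal (ord_term c i) \<ominus>\<^sub>F ereal (fermat_order c))))) p"

text \<open>The remaining cases, in which the power is not defined, are mapped to \<open>0\<close>.\<close>

definition fermat_powr :: "fermat \<Rightarrow> real \<Rightarrow> fermat" (infixr \<open>powr\<^sub>F\<close> 80) where
  "x powr\<^sub>F p =
     (if std_part x > 0 then unit_powr x p
      else if x \<in> D_inf \<and> x > 0 \<and> p > 0 then inf_powr x p
      else 0)"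

subsection \<open>Powers are independent of the choice of representatives\<close>

lemma binomial_remainder:
  "(\<lambda>z::real. (1 + z) powr p - (\<Sum>k<n. (p gchoose k) * z ^ k)) \<in> O[nhds 0](\<lambda>z. z ^ n)"
proof -
  define G where "G z = (\<Sum>k. (p gchoose (k + n)) * z ^ k)" for z :: real
  have sums: "(\<lambda>k. (p gchoose k) * z ^ k) sums (1 + z) powr p" if "\<bar>z\<bar> < 1" for z
    using gen_binomial_real[OF that] .
  have summ: "summable (\<lambda>k. (p gchoose (k + n)) * z ^ k)" if "\<bar>z\<bar> < 1" for z
  proof (cases "z = 0")
    case False
    have "summable (\<lambda>k. (p gchoose (k + n)) * z ^ (k + n))"
      using sums_summable[OF sums[OF that]] by (rule summable_ignore_initial_segment)
    hence "summable (\<lambda>k. (p gchoose (k + n)) * z ^ (k + n) / z ^ n)"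
      by (rule summable_divide)
    thus ?thesis using False by (simp add: power_add)
  qed (auto intro: powser_zero summable_finite[of "{0}"])
  have eq: "(1 + z) powr p - (\<Sum>k<n. (p gchoose k) * z ^ k) = z ^ n * G z" if "\<bar>z\<bar> < 1" for z
  proof -
    have "(1 + z) powr p = (\<Sum>k. (p gchoose k) * z ^ k)"
      using sums_unique[OF sums[OF that]] .
    also have "\<dots> = (\<Sum>k. (p gchoose (k + n)) * z ^ (k + n)) + (\<Sum>k<n. (p gchoose k) * z ^ k)"
      by (rule suminf_split_initial_segment[OF sums_summable[OF sums[OF that]]])
    also have "(\<Sum>k. (p gchoose (k + n)) * z ^ (k + n)) =
        (\<Sum>k. z ^ n * ((p gchoose (k + n)) * z ^ k))"
      by (intro suminf_cong) (simp add: power_add mult_ac)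
    also have "\<dots> = z ^ n * G z"
      unfolding G_def by (rule suminf_mult[OF summ[OF that]])
    finally show ?thesis by simp
  qed
  have "isCont G 0"
    unfolding G_def by (rule isCont_powser[of _ "1/2"]) (use summ[of "1/2"] in auto)
  hence "(G \<longlongrightarrow> G 0) (nhds 0)"
    by (simp only: isCont_def tendsto_at_iff_tendsto_nhds)
  hence "G \<in> O[nhds 0](\<lambda>_. 1)"
    by (intro bigoI_tendsto[of _ _ "G 0"]) auto
  hence *: "(\<lambda>z. z ^ n * G z) \<in> O[nhds 0](\<lambda>z. z ^ n * 1)"
    by (intro landau_o.big.mult) auto
  have "\<forall>\<^sub>F z in nhds 0. \<bar>z::real\<bar> < 1"
    using eventually_nhds_ball[of 1 "0::real"] by (auto elim: eventually_mono)
  hence "\<forall>\<^sub>F z in nhds 0. (1 + z) powr p - (\<Sum>k<n. (p gchoose k) * z ^ k) = z ^ n * G z"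
    by eventually_elim (rule eq)
  with * show ?thesis by (subst landau_o.big.in_cong) auto
qed

lemma std_part_decomp:
  obtains W c where "finite W" "W \<subseteq> {1..}" "x = of_real (std_part x) + (\<Sum>w\<in>W. c w *\<^sub>R dt w)"
proof -
  have "is_decomposition x (fst (decomposition x)) (snd (decomposition x))"
    unfolding decomposition_def by (rule theI'[OF ex1_decomposition])
  hence dec: "is_decomposition x (std_part x) (snd (decomposition x))"
    by (simp add: std_part_def)
  let ?ps = "snd (decomposition x)"
  have "\<exists>c. (\<Sum>(a, w)\<leftarrow>ps. a *\<^sub>R dt w) = (\<Sum>w\<in>snd ` set ps. c w *\<^sub>R dt w)"
    for ps :: "(real \<times> real) list"
  proof (induction ps)
    case (Cons p ps)
    then obtain c where c: "(\<Sum>(a, w)\<leftarrow>ps. a *\<^sub>R dt w) = (\<Sum>w\<in>snd ` set ps. c w *\<^sub>R dt w)" by blast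
    obtain a v where p: "p = (a, v)" by fastforce
    define W where "W = snd ` set ps"
    define c' where "c' w = (if w = v then a else 0) + (if w \<in> W then c w else 0)" for w
    have [simp]: "finite W" by (simp add: W_def)
    have "(\<Sum>w\<in>insert v W. c' w *\<^sub>R dt w) =
       (\<Sum>w\<in>insert v W. (if w = v then a *\<^sub>R dt w else 0)) +
       (\<Sum>w\<in>insert v W. (if w \<in> W then c w *\<^sub>R dt w else 0))"
      unfolding sum.distrib[symmetric]
      by (intro sum.cong) (auto simp: c'_def scaleR_add_left)
    also have "(\<Sum>w\<in>insert v W. (if w = v then a *\<^sub>R dt w else 0)) = a *\<^sub>R dt v"
      by (subst sum.delta) auto
    also have "(\<Sum>w\<in>insert v W. (if w \<in> W then c w *\<^sub>R dt w else 0)) = (\<Sum>w\<in>W. c w *\<^sub>R dt w)"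
      by (intro sum.mono_neutral_cong_right) auto
    finally show ?case using c by (intro exI[of _ c']) (simp add: p W_def)
  qed simp
  then obtain c where "(\<Sum>(a, w)\<leftarrow>?ps. a *\<^sub>R dt w) = (\<Sum>w\<in>snd ` set ?ps. c w *\<^sub>R dt w)" by blast
  with dec show ?thesis
    by (intro that[of "snd ` set ?ps" c]) (auto simp: is_decomposition_def)
qed

lemma abs_fermat_polynomial:
  assumes "little_oh_poly f"
  shows "little_oh_poly (\<lambda>t. \<Sum>k<n. b k * f t ^ k)"
    and "abs_fermat (\<lambda>t. \<Sum>k<n. b k * f t ^ k) = (\<Sum>k<n. b k *\<^sub>R abs_fermat f ^ k)"
proof -
  have pow: "little_oh_poly (\<lambda>t. f t ^ k) \<and> abs_fermat (\<lambda>t. f t ^ k) = abs_fermat f ^ k" for k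
  proof (induction k)
    case (Suc k)
    thus ?case using assms abs_fermat_mult[of f "\<lambda>t. f t ^ k"] by (auto intro: little_oh_poly_mult)
  qed (auto simp: little_oh_poly_const one_fermat_def)
  have "little_oh_poly (\<lambda>t. \<Sum>k<n. b k * f t ^ k) \<and>
    abs_fermat (\<lambda>t. \<Sum>k<n. b k * f t ^ k) = (\<Sum>k<n. b k *\<^sub>R abs_fermat f ^ k)"
  proof (induction n)
    case (Suc n)
    have "little_oh_poly (\<lambda>t. b n * f t ^ n)"
      and "abs_fermat (\<lambda>t. b n * f t ^ n) = b n *\<^sub>R abs_fermat f ^ n"
      using pow[of n] abs_fermat_scaleR[of "\<lambda>t. f t ^ n" "b n"]
      by (simp_all add: little_oh_poly_cmult)
    with Suc show ?case
      using abs_fermat_add[of "\<lambda>t. \<Sum>k<n. b k * f t ^ k" "\<lambda>t. b n * f t ^ n"]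
      by (simp add: little_oh_poly_add)
  qed (auto simp: little_oh_poly_const zero_fermat_def)
  thus "little_oh_poly (\<lambda>t. \<Sum>k<n. b k * f t ^ k)"
    "abs_fermat (\<lambda>t. \<Sum>k<n. b k * f t ^ k) = (\<Sum>k<n. b k *\<^sub>R abs_fermat f ^ k)" by auto
qed

lemma abs_fermat_powr:
  assumes "std_part y > 0"
  shows "\<exists>n. \<forall>f. little_oh_poly f \<and> abs_fermat f = y \<longrightarrow>
    little_oh_poly (\<lambda>t. f t powr p) \<and>
    abs_fermat (\<lambda>t. f t powr p) = (std_part y powr p) *\<^sub>R
      (\<Sum>k<n. (p gchoose k) *\<^sub>R (y /\<^sub>R std_part y - 1) ^ k)"
proof -
  define r where "r = std_part y"
  have r: "r > 0" using assms by (simp add: r_def)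
  obtain W c where W: "finite W" "W \<subseteq> {1..}" "y = of_real r + (\<Sum>w\<in>W. c w *\<^sub>R dt w)"
    using std_part_decomp[of y] unfolding r_def by blast
  define S where "S = insert 1 ((\<lambda>w. 1 / w) ` W)"
  define \<delta> where "\<delta> = Min S"
  have "finite S" "S \<noteq> {}" using W(1) by (auto simp: S_def)
  hence "\<delta> \<in> S" and \<delta>_le: "\<And>s. s \<in> S \<Longrightarrow> \<delta> \<le> s"
    unfolding \<delta>_def by (auto intro: Min_in Min_le)
  hence \<delta>: "\<delta> > 0" "\<delta> \<le> 1" using W(2) by (auto simp: S_def)
  obtain n :: nat where n: "real n * \<delta> > 1"
    using reals_Archimedean3[OF \<delta>(1)] by blast
  have lt1: "\<forall>\<^sub>F t::real in at_right 0. t < 1"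
    by (rule eventually_at_rightI[of 0 1]) auto
  have powr_bigo: "(\<lambda>t::real. t powr s) \<in> O[at_right 0](\<lambda>t. t powr \<delta>)" if "\<delta> \<le> s" for s
  proof (rule bigoI[of _ 1])
    show "\<forall>\<^sub>F t::real in at_right 0. norm (t powr s) \<le> 1 * norm (t powr \<delta>)"
      using ev_right_pos lt1 by eventually_elim (use that in \<open>auto intro: powr_mono'\<close>)
  qed
  have id_bigo: "(\<lambda>t::real. t) \<in> O[at_right 0](\<lambda>t. t powr \<delta>)"
  proof (rule landau_o.big.in_cong[THEN iffD1, OF _ powr_bigo[OF \<delta>(2)]])
    show "\<forall>\<^sub>F t::real in at_right 0. t powr 1 = t"
      using ev_right_pos by eventually_elim auto
  qed
  have "little_oh_poly (\<lambda>t. f t powr p) \<and>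
    abs_fermat (\<lambda>t. f t powr p) =
      (r powr p) *\<^sub>R (\<Sum>k<n. (p gchoose k) *\<^sub>R (y /\<^sub>R r - 1) ^ k)"
    if f: "little_oh_poly f" "abs_fermat f = y" for f
  proof -
    define h where "h t = (\<Sum>w\<in>W. c w * t powr (1 / w))" for t
    define z where "z t = inverse r * f t + (-1)" for t
    have "(\<lambda>t. f t - (r + h t)) \<in> o[at_right 0](\<lambda>t. t)"
      using sum_dt_eq[OF W(1,2), of r c] f W(3) abs_fermat_eq_iff[of f "\<lambda>t. r + h t"]
      by (simp add: h_def)
    hence "(\<lambda>t. f t - (r + h t)) \<in> O[at_right 0](\<lambda>t. t powr \<delta>)"
      using landau_o.small_imp_big id_bigo landau_o.big_trans by blast
    moreover have "h \<in> O[at_right 0](\<lambda>t. t powr \<delta>)"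
      unfolding h_def
    proof (rule big_sum_in_bigo)
      fix w assume "w \<in> W"
      hence "(\<lambda>t. t powr (1 / w)) \<in> O[at_right 0](\<lambda>t. t powr \<delta>)"
        by (intro powr_bigo \<delta>_le) (auto simp: S_def)
      thus "(\<lambda>t. c w * t powr (1 / w)) \<in> O[at_right 0](\<lambda>t. t powr \<delta>)" by simp
    qed
    ultimately have "(\<lambda>t. inverse r * ((f t - (r + h t)) + h t)) \<in> O[at_right 0](\<lambda>t. t powr \<delta>)"
      using r by (intro landau_o.big.cmult_in_iff[THEN iffD2] sum_in_bigo(1)) auto
    also have "(\<lambda>t. inverse r * ((f t - (r + h t)) + h t)) = z"
      using r by (auto simp: z_def fun_eq_iff field_simps)
    finally have z: "z \<in> O[at_right 0](\<lambda>t. t powr \<delta>)" .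
    have z0: "(z \<longlongrightarrow> 0) (at_right 0)"
    proof -
      from z obtain C where C: "\<forall>\<^sub>F t in at_right 0. norm (z t) \<le> C * norm (t powr \<delta>)"
        by (elim landau_o.bigE)
      have "((\<lambda>t::real. C * norm (t powr \<delta>)) \<longlongrightarrow> C * norm (0::real)) (at_right 0)"
        by (intro tendsto_intros tendsto_powr_right \<delta>)
      hence "((\<lambda>t::real. C * norm (t powr \<delta>)) \<longlongrightarrow> 0) (at_right 0)" by simp
      from Lim_null_comparison[OF C this] show ?thesis .
    qed
    define B where "B t = (\<Sum>k<n. (p gchoose k) * z t ^ k)" for t
    have poly_z: "little_oh_poly z"
      unfolding z_def using f(1) by (intro little_oh_poly_add little_oh_poly_cmult little_oh_poly_const)
    have "abs_fermat z = inverse r *\<^sub>R y + abs_fermat (\<lambda>_. -1)"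
      unfolding z_def f(2)[symmetric]
      using f(1) by (simp add: abs_fermat_scaleR abs_fermat_add little_oh_poly_cmult little_oh_poly_const)
    also have "abs_fermat (\<lambda>_. -1) = -1"
      using of_real_fermat[of "-1"] by simp
    finally have abs_z: "abs_fermat z = y /\<^sub>R r - 1" by simp
    have B: "little_oh_poly B" "abs_fermat B = (\<Sum>k<n. (p gchoose k) *\<^sub>R (y /\<^sub>R r - 1) ^ k)"
      unfolding B_def abs_z[symmetric] by (intro abs_fermat_polynomial poly_z)+
    have "(\<lambda>t. (1 + z t) powr p - B t) \<in> O[at_right 0](\<lambda>t. z t ^ n)"
      unfolding B_def by (rule landau_o.big.compose[OF binomial_remainder z0])
    also have "(\<lambda>t. z t ^ n) \<in> O[at_right 0](\<lambda>t. (t powr \<delta>) ^ n)"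
      by (rule landau_o.big_power[OF z])
    also have "(\<lambda>t::real. (t powr \<delta>) ^ n) \<in> o[at_right 0](\<lambda>t. t)"
    proof (rule smalloI_tendsto)
      have "((\<lambda>t::real. t powr (real n * \<delta> - 1)) \<longlongrightarrow> 0) (at_right 0)"
        using n by (intro tendsto_powr_right) simp
      moreover have "\<forall>\<^sub>F t::real in at_right 0. t powr (real n * \<delta> - 1) = (t powr \<delta>) ^ n / t"
        using ev_right_pos
        by eventually_elim (simp add: powr_diff powr_power mult.commute)
      ultimately show "((\<lambda>t::real. (t powr \<delta>) ^ n / t) \<longlongrightarrow> 0) (at_right 0)"
        by (rule Lim_transform_eventually)
      show "\<forall>\<^sub>F t::real in at_right 0. t \<noteq> 0"
        using ev_right_pos by eventually_elim auto
    qed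
    finally have "(\<lambda>t. (1 + z t) powr p - B t) \<in> o[at_right 0](\<lambda>t. t)" .
    hence "(\<lambda>t. r powr p * ((1 + z t) powr p - B t)) \<in> o[at_right 0](\<lambda>t. t)"
      using r by simp
    also have "(\<lambda>t. r powr p * ((1 + z t) powr p - B t)) = (\<lambda>t. f t powr p - r powr p * B t)"
    proof
      fix t
      have "f t = r * (1 + z t)" using r by (simp add: z_def field_simps)
      thus "r powr p * ((1 + z t) powr p - B t) = f t powr p - r powr p * B t"
        by (simp add: powr_mult right_diff_distrib)
    qed
    finally have *: "(\<lambda>t. f t powr p - r powr p * B t) \<in> o[at_right 0](\<lambda>t. t)" .
    have poly: "little_oh_poly (\<lambda>t. r powr p * B t)" by (rule little_oh_poly_cmult[OF B(1)])
    from little_oh_poly_cong[OF this *] have poly': "little_oh_poly (\<lambda>t. f t powr p)" .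
    from abs_fermat_eq_iff[OF this poly] * poly' show ?thesis
      using B by (simp add: abs_fermat_scaleR[symmetric])
  qed
  thus ?thesis unfolding r_def by blast
qed

theorem unit_powr_abs:
  assumes "little_oh_poly f" "std_part (abs_fermat f) > 0"
  shows "little_oh_poly (\<lambda>t. f t powr p)"
    and "unit_powr (abs_fermat f) p = abs_fermat (\<lambda>t. f t powr p)"
proof -
  let ?g = "rep_fermat (abs_fermat f)"
  obtain n where n: "\<forall>g. little_oh_poly g \<and> abs_fermat g = abs_fermat f \<longrightarrow>
    little_oh_poly (\<lambda>t. g t powr p) \<and>
    abs_fermat (\<lambda>t. g t powr p) = (std_part (abs_fermat f) powr p) *\<^sub>R
      (\<Sum>k<n. (p gchoose k) *\<^sub>R (abs_fermat f /\<^sub>R std_part (abs_fermat f) - 1) ^ k)"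
    using abs_fermat_powr[OF assms(2), of p] by blast
  from n assms(1) show "little_oh_poly (\<lambda>t. f t powr p)" by blast
  have "little_oh_poly ?g" "abs_fermat ?g = abs_fermat f"
    by (rule little_oh_poly_rep, rule abs_rep_fermat)
  with n assms(1) show "unit_powr (abs_fermat f) p = abs_fermat (\<lambda>t. f t powr p)"
    unfolding unit_powr_def by simp
qed

end

theory Submission
  imports Defs
begin

text \<open>
  Let \<open>f\<close> be the canonical representative of \<open>x\<close>, read off from the decomposition. Factoring out
  its leading term shows that \<open>x powr\<^sub>F q\<close> is the class of \<open>f powr q\<close> for every \<open>q > 0\<close>. The
  canonical representative \<open>g\<close> of \<open>x powr\<^sub>F q\<close> thus differs from \<open>f powr q\<close> by an error \<open>o(t)\<close>.

  If \<open>q = p < 1\<close>, the map \<open>u \<mapsto> u powr (1 / p)\<close> is Lipschitz on \<open>[0, 1]\<close>, so the error remains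
  \<open>o(t)\<close>, which gives (1). If \<open>q = 1 / p\<close>, the map \<open>u \<mapsto> u powr p\<close> may enlarge the error, but the
  limit of \<open>g(t) powr p / t powr (1 / \<omega>(x))\<close> shows that the leading term survives, which gives (2).
\<close>

section \<open>Canonical representatives and their limits at 0\<close>

definition normal_form :: "fermat \<Rightarrow> real \<Rightarrow> real" where
  "normal_form x t =
     std_part x + (\<Sum>i=1..num_terms x. std_coeff x i * t powr (1 / ord_term x i))"

text \<open>By \<open>ex1_decomposition\<close> the \<open>THE\<close> in
  \<open>decomposition\<close> is well defined, so its defining properties hold. They are
  transferred here from list positions, counted from 0, to indices counted from 1.\<close>

lemma eq_sum_std_coeff:
  "x = of_real (std_part x) + (\<Sum>i=1..num_terms x. std_coeff x i *\<^sub>R dt (ord_term x i))"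
  and std_coeff_nonzero: "i \<in> {1..num_terms x} \<Longrightarrow> std_coeff x i \<noteq> 0"
  and ord_term_ge_1: "i \<in> {1..num_terms x} \<Longrightarrow> ord_term x i \<ge> 1"
  and ord_term_less: "1 \<le> i \<Longrightarrow> i < j \<Longrightarrow> j \<le> num_terms x \<Longrightarrow> ord_term x j < ord_term x i"
proof -
  define ps where "ps = snd (decomposition x)"
  have "is_decomposition x (fst (decomposition x)) (snd (decomposition x))"
    unfolding decomposition_def by (rule theI'[OF ex1_decomposition])
  hence dec: "x = of_real (std_part x) + (\<Sum>(a, w)\<leftarrow>ps. a *\<^sub>R dt w)"
    "sorted_wrt (>) (map snd ps)" "\<And>a w. (a, w) \<in> set ps \<Longrightarrow> a \<noteq> 0 \<and> w \<ge> 1"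
    by (auto simp: std_part_def is_decomposition_def ps_def)
  have N: "num_terms x = length ps" by (simp add: num_terms_def ps_def)
  have nth: "(std_coeff x i, ord_term x i) = ps ! (i - 1)" if "i \<in> {1..num_terms x}" for i
    using that by (simp add: std_coeff_def ord_term_def ps_def)
  have "(\<Sum>(a, w)\<leftarrow>ps. a *\<^sub>R dt w) = (\<Sum>k<length ps. case ps ! k of (a, w) \<Rightarrow> a *\<^sub>R dt w)"
    by (simp add: sum_list_sum_nth atLeast0LessThan)
  also have "\<dots> = (\<Sum>k<num_terms x. std_coeff x (Suc k) *\<^sub>R dt (ord_term x (Suc k)))"
    using nth[symmetric, of "Suc _"] by (intro sum.cong) (auto simp: N)
  also have "\<dots> = (\<Sum>i=1..num_terms x. std_coeff x i *\<^sub>R dt (ord_term x i))"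
    by (simp add: sum.atLeast1_atMost_eq)
  finally show "x = of_real (std_part x) +
      (\<Sum>i=1..num_terms x. std_coeff x i *\<^sub>R dt (ord_term x i))"
    using dec(1) by simp
  have in_set: "(std_coeff x i, ord_term x i) \<in> set ps" if "i \<in> {1..num_terms x}" for i
    unfolding nth[OF that] using that by (intro nth_mem) (auto simp: N)
  from dec(3)[OF this]
  show "i \<in> {1..num_terms x} \<Longrightarrow> std_coeff x i \<noteq> 0"
    "i \<in> {1..num_terms x} \<Longrightarrow> ord_term x i \<ge> 1" by blast+
  assume ij: "1 \<le> i" "i < j" "j \<le> num_terms x"
  hence "map snd ps ! (i - 1) > map snd ps ! (j - 1)"
    by (intro sorted_wrt_nth_less[OF dec(2)]) (auto simp: N)
  with ij show "ord_term x j < ord_term x i"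
    using nth[of i, symmetric] nth[of j, symmetric] by (simp add: N)
qed

lemma abs_fermat_sum:
  assumes "finite A" "\<And>i. i \<in> A \<Longrightarrow> little_oh_poly (f i)"
  shows "little_oh_poly (\<lambda>t. \<Sum>i\<in>A. f i t) \<and>
    abs_fermat (\<lambda>t. \<Sum>i\<in>A. f i t) = (\<Sum>i\<in>A. abs_fermat (f i))"
  using assms
proof (induction A rule: finite_induct)
  case (insert i A)
  hence "little_oh_poly (f i)" "little_oh_poly (\<lambda>t. \<Sum>i\<in>A. f i t)" by auto
  from little_oh_poly_add[OF this] abs_fermat_add[OF this, symmetric] insert show ?case by simp
qed (simp add: little_oh_poly_const zero_fermat_def)

lemma abs_fermat_add_sum_dt:
  fixes a w :: "nat \<Rightarrow> real"
  assumes "finite A" "\<And>i. i \<in> A \<Longrightarrow> w i > 0"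
  shows "little_oh_poly (\<lambda>t. r + (\<Sum>i\<in>A. a i * t powr (1 / w i)))"
    and "abs_fermat (\<lambda>t. r + (\<Sum>i\<in>A. a i * t powr (1 / w i))) =
      of_real r + (\<Sum>i\<in>A. a i *\<^sub>R dt (w i))"
proof -
  have monom: "little_oh_poly (\<lambda>t. a i * t powr (1 / w i))" if "i \<in> A" for i
    using assms(2)[OF that] by (intro little_oh_poly_cmult little_oh_poly_monom) simp
  have abs: "abs_fermat (\<lambda>t. a i * t powr (1 / w i)) = a i *\<^sub>R dt (w i)" if "i \<in> A" for i
    using assms(2)[OF that] little_oh_poly_monom[of "1 / w i"]
    by (simp add: dt_def abs_fermat_scaleR)
  note sum = abs_fermat_sum[OF assms(1), of "\<lambda>i t. a i * t powr (1 / w i)", OF monom]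
  show "little_oh_poly (\<lambda>t. r + (\<Sum>i\<in>A. a i * t powr (1 / w i)))"
    using sum by (intro little_oh_poly_add little_oh_poly_const) simp
  show "abs_fermat (\<lambda>t. r + (\<Sum>i\<in>A. a i * t powr (1 / w i))) =
      of_real r + (\<Sum>i\<in>A. a i *\<^sub>R dt (w i))"
    using sum abs_fermat_add[OF little_oh_poly_const, of "\<lambda>t. \<Sum>i\<in>A. a i * t powr (1 / w i)" r]
    by (simp add: of_real_fermat abs)
qed

lemma little_oh_poly_normal_form: "little_oh_poly (normal_form x)"
  and abs_fermat_normal_form: "abs_fermat (normal_form x) = x"
proof -
  have pos: "ord_term x i > 0" if "i \<in> {1..num_terms x}" for i
    using ord_term_ge_1[OF that] by simp
  have nf: "normal_form x = (\<lambda>t. std_part x +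
      (\<Sum>i=1..num_terms x. std_coeff x i * t powr (1 / ord_term x i)))"
    by (simp add: normal_form_def fun_eq_iff)
  show "little_oh_poly (normal_form x)"
    unfolding nf by (rule abs_fermat_add_sum_dt[OF _ pos]) simp_all
  show "abs_fermat (normal_form x) = x"
    unfolding nf by (rule trans[OF abs_fermat_add_sum_dt(2) eq_sum_std_coeff[symmetric]])
      (use pos in auto)
qed

lemma normal_form_diff_smallo:
  assumes "little_oh_poly f"
  shows "(\<lambda>t. normal_form (abs_fermat f) t - f t) \<in> o[at_right 0](\<lambda>t. t)"
  using abs_fermat_eq_iff[OF little_oh_poly_normal_form assms, of "abs_fermat f"] by (simp add: abs_fermat_normal_form)

text \<open>The laws of \<open>powr\<close> are applied for \<open>t > 0\<close>, so representatives
  are compared only eventually at the right of 0.\<close>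

lemma abs_fermat_cong:
  assumes "little_oh_poly f" "\<forall>\<^sub>F t in at_right 0. f t = g t"
  shows "little_oh_poly g" and "abs_fermat g = abs_fermat f"
proof -
  have *: "(\<lambda>t. g t - f t) \<in> o[at_right 0](\<lambda>t. t)"
    by (rule landau_o.small.in_cong[THEN iffD2, of _ "\<lambda>_. 0"])
      (use assms(2) in \<open>auto elim: eventually_mono\<close>)
  show "little_oh_poly g" using little_oh_poly_cong[OF assms(1) *] .
  from abs_fermat_eq_iff[OF this assms(1)] * show "abs_fermat g = abs_fermat f" by simp
qed

text \<open>Near 0, \<open>t \<le> t powr s\<close> for \<open>s \<le> 1\<close>, so dividing by
  \<open>t powr s\<close> gives at most the absolute value of dividing by \<open>t\<close>.\<close>

lemma tendsto_smallo_div_powr: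
  fixes h :: "real \<Rightarrow> real"
  assumes "h \<in> o[at_right 0](\<lambda>t. t)" "s \<le> 1"
  shows "((\<lambda>t. h t / t powr s) \<longlongrightarrow> 0) (at_right 0)"
proof (rule Lim_null_comparison)
  have "eventually (\<lambda>t::real. t < 1) (at_right 0)"
    by (rule eventually_at_rightI[of 0 1]) auto
  with ev_right_pos show "\<forall>\<^sub>F t in at_right 0. norm (h t / t powr s) \<le> \<bar>h t / t\<bar>"
  proof eventually_elim
    case (elim t)
    hence "t powr 1 \<le> t powr s" using assms(2) by (intro powr_mono') auto
    with elim show ?case by (auto intro: divide_left_mono)
  qed
  show "((\<lambda>t. \<bar>h t / t\<bar>) \<longlongrightarrow> 0) (at_right 0)"
    using tendsto_rabs[OF smalloD_tendsto[OF assms(1)]] by simp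
qed

text \<open>Scales \<open>t powr s\<close> with \<open>s \<le> 1\<close> do not see errors
  \<open>o(t)\<close>, so asymptotics at such scales can be read off any representative.\<close>

lemma tendsto_normal_form_iff:
  assumes "little_oh_poly f" "s \<le> 1"
  shows "((\<lambda>t. normal_form (abs_fermat f) t / t powr s) \<longlongrightarrow> a) (at_right 0) \<longleftrightarrow>
    ((\<lambda>t. f t / t powr s) \<longlongrightarrow> a) (at_right 0)"
  using tendsto_smallo_div_powr[OF normal_form_diff_smallo[OF assms(1)] assms(2)]
  by (intro Lim_transform_eq) (simp add: diff_divide_distrib)

lemma tendsto_normal_form: "(normal_form x \<longlongrightarrow> std_part x) (at_right 0)"
proof -
  have "((\<lambda>t. std_part x + (\<Sum>i=1..num_terms x. std_coeff x i * t powr (1 / ord_term x i)))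
      \<longlongrightarrow> std_part x + (\<Sum>i=1..num_terms x. std_coeff x i * 0)) (at_right 0)"
    by (intro tendsto_intros tendsto_powr_right) (use ord_term_ge_1 in force)
  thus ?thesis by (simp add: normal_form_def[abs_def])
qed

text \<open>This is the scale \<open>s = 0\<close>. Since \<open>0 powr 0 = 0\<close>, the factor
  \<open>t powr 0\<close> is 1 only away from 0, which is why it is removed eventually.\<close>

lemma std_part_abs_fermat:
  assumes "little_oh_poly f" "(f \<longlongrightarrow> r) (at_right 0)"
  shows "std_part (abs_fermat f) = r"
proof -
  have pw0: "\<forall>\<^sub>F t::real in at_right 0. t powr 0 = 1" using ev_right_pos by eventually_elim simp
  have "((\<lambda>t. f t / t powr 0) \<longlongrightarrow> r) (at_right 0)"
    by (rule Lim_transform_eventually[OF assms(2)]) (use pw0 in eventually_elim, simp)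
  hence "((\<lambda>t. normal_form (abs_fermat f) t / t powr 0) \<longlongrightarrow> r) (at_right 0)"
    using tendsto_normal_form_iff[OF assms(1), of 0 r] by simp
  hence "(normal_form (abs_fermat f) \<longlongrightarrow> r) (at_right 0)"
    by (rule Lim_transform_eventually) (use pw0 in eventually_elim, simp)
  with tendsto_normal_form show ?thesis
    using tendsto_unique[OF trivial_limit_at_right_real] by blast
qed

section \<open>Leading terms of infinitesimals\<close>

text \<open>The factor multiplying the leading term of a decomposition: the base of the outer power in
  the definition of \<^const>\<open>inf_powr\<close>.\<close>

definition leading_cofactor :: "fermat \<Rightarrow> real \<Rightarrow> real" where
  "leading_cofactor x t = 1 + (\<Sum>i=2..num_terms x.
     std_coeff x i / std_coeff x 1 * t powr (1 / ord_term x i - 1 / fermat_order x))"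

text \<open>The orders decrease strictly, so the difference of reciprocals is positive and the
  operation on \<open>ereal\<close> reduces to real arithmetic.\<close>

lemma inverse_ord_term_diff:
  assumes "i \<in> {2..num_terms x}"
  shows "1 / ord_term x i - 1 / fermat_order x > 0" (is "?d > 0")
    and "real_of_ereal (ereal (ord_term x i) \<ominus>\<^sub>F ereal (fermat_order x)) =
    1 / (1 / ord_term x i - 1 / fermat_order x)" (is "?r = _")
proof -
  have *: "ord_term x i < fermat_order x" "ord_term x i \<ge> 1"
    unfolding fermat_order_def using assms ord_term_less[of 1 i x] ord_term_ge_1[of i x] by auto
  show "?d > 0" using * by (simp add: frac_less2)
  thus "?r = 1 / ?d"
    using * by (simp add: ominus_def inverse_eq_divide)
qed

lemma tendsto_leading_cofactor: "(leading_cofactor x \<longlongrightarrow> 1) (at_right 0)"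
proof -
  have "((\<lambda>t. 1 + (\<Sum>i=2..num_terms x.
       std_coeff x i / std_coeff x 1 * t powr (1 / ord_term x i - 1 / fermat_order x)))
     \<longlongrightarrow> 1 + (\<Sum>i=2..num_terms x. std_coeff x i / std_coeff x 1 * 0)) (at_right 0)"
    by (intro tendsto_intros tendsto_powr_right) (rule inverse_ord_term_diff)
  thus ?thesis by (simp add: leading_cofactor_def[abs_def])
qed

lemma normal_form_factor:
  assumes "std_part x = 0" "num_terms x \<ge> 1" "t > 0"
  shows "normal_form x t = std_coeff x 1 * t powr (1 / fermat_order x) * leading_cofactor x t"
proof -
  have nz: "std_coeff x 1 \<noteq> 0" using assms(2) by (intro std_coeff_nonzero) auto
  have "normal_form x t = std_coeff x 1 * t powr (1 / fermat_order x) +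
      (\<Sum>i=2..num_terms x. std_coeff x i * t powr (1 / ord_term x i))"
    using assms(1,2) by (simp add: normal_form_def fermat_order_def sum.atLeast_Suc_atMost numeral_2_eq_2)
  also have "(\<Sum>i=2..num_terms x. std_coeff x i * t powr (1 / ord_term x i)) =
      (\<Sum>i=2..num_terms x. std_coeff x 1 * t powr (1 / fermat_order x) *
        (std_coeff x i / std_coeff x 1 * t powr (1 / ord_term x i - 1 / fermat_order x)))"
    using nz assms(3) by (intro sum.cong) (auto simp: powr_diff)
  finally show ?thesis by (simp add: leading_cofactor_def sum_distrib_left ring_distribs)
qed

text \<open>After the leading monomial is factored out, only the cofactor depends on
  \<open>t\<close>, and it tends to 1.\<close>

lemma tendsto_normal_form_leading:
  assumes "std_part x = 0" "num_terms x \<ge> 1"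
  shows "((\<lambda>t. normal_form x t / t powr (1 / fermat_order x)) \<longlongrightarrow> std_coeff x 1) (at_right 0)"
proof (rule Lim_transform_eventually)
  show "((\<lambda>t. std_coeff x 1 * leading_cofactor x t) \<longlongrightarrow> std_coeff x 1) (at_right 0)"
    using tendsto_mult[OF tendsto_const tendsto_leading_cofactor, of "std_coeff x 1"] by simp
  show "\<forall>\<^sub>F t in at_right 0. std_coeff x 1 * leading_cofactor x t =
      normal_form x t / t powr (1 / fermat_order x)"
    using ev_right_pos by eventually_elim (simp add: normal_form_factor[OF assms])
qed

lemma num_terms_pos:
  assumes "std_part x = 0" "x \<noteq> 0"
  shows "num_terms x \<ge> 1"
proof (rule ccontr)
  assume "\<not> num_terms x \<ge> 1"
  with eq_sum_std_coeff[of x] assms show False by simp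
qed

lemma less_fermat_0_iff: "0 < x \<longleftrightarrow> fermat_pos x" for x :: fermat
  by (simp add: less_fermat_def)

lemma pos_infinitesimal:
  assumes "x \<in> D_inf" "x > 0"
  shows "std_part x = 0" "num_terms x \<ge> 1" "std_coeff x 1 > 0" "fermat_order x \<ge> 1"
proof -
  show "std_part x = 0" "num_terms x \<ge> 1" "std_coeff x 1 > 0"
    using assms num_terms_pos[of x] by (auto simp: D_inf_def less_fermat_0_iff fermat_pos_def)
  thus "fermat_order x \<ge> 1"
    unfolding fermat_order_def by (intro ord_term_ge_1) auto
qed

text \<open>If \<open>s < s'\<close>, then \<open>h t / t powr s\<close> is
  \<open>h t / t powr s'\<close> times \<open>t powr (s' - s)\<close> and tends to 0, contradicting
  \<open>a \<noteq> 0\<close>. By symmetry the exponents agree, and then limits are unique.\<close>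

lemma tendsto_powr_unique:
  fixes h :: "real \<Rightarrow> real"
  assumes "((\<lambda>t. h t / t powr s) \<longlongrightarrow> a) (at_right 0)" "((\<lambda>t. h t / t powr s') \<longlongrightarrow> a') (at_right 0)"
    and "a \<noteq> 0" "a' \<noteq> 0"
  shows "s = s'" "a = a'"
proof -
  have le: "\<not> s < s'"
    if "((\<lambda>t. h t / t powr s) \<longlongrightarrow> a) (at_right 0)" "((\<lambda>t. h t / t powr s') \<longlongrightarrow> a') (at_right 0)" "a \<noteq> 0"
    for s s' a a'
  proof
    assume "s < s'"
    hence "((\<lambda>t. h t / t powr s' * t powr (s' - s)) \<longlongrightarrow> a' * 0) (at_right 0)"
      by (intro tendsto_mult that tendsto_powr_right) simp
    hence "((\<lambda>t. h t / t powr s' * t powr (s' - s)) \<longlongrightarrow> 0) (at_right 0)" by simp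
    hence "((\<lambda>t. h t / t powr s) \<longlongrightarrow> 0) (at_right 0)"
      by (rule Lim_transform_eventually)
        (use ev_right_pos in eventually_elim, simp add: powr_diff)
    with that show False
      using tendsto_unique[OF trivial_limit_at_right_real] by blast
  qed
  from le[OF assms(1,2,3)] le[OF assms(2,1,4)] show "s = s'" by simp
  with assms(1,2) show "a = a'"
    using tendsto_unique[OF trivial_limit_at_right_real] by blast
qed

text \<open>The asymptotics of one representative determine the first term of the decomposition:
  \<open>normal_form\<close> has the same limit at scale \<open>s\<close>, and exponent and
  coefficient of a nonzero limit are unique. The bound \<open>s \<le> 1\<close> keeps the term from
  being \<open>o(t)\<close>.\<close>

lemma leading_term_abs_fermat:
  assumes "little_oh_poly f" "0 < s" "s \<le> 1" "a > 0"
    and "((\<lambda>t. f t / t powr s) \<longlongrightarrow> a) (at_right 0)"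
  shows "abs_fermat f \<in> D_inf" "abs_fermat f > 0"
    "fermat_order (abs_fermat f) = 1 / s" "std_coeff (abs_fermat f) 1 = a"
proof -
  define x where "x = abs_fermat f"
  have lim: "((\<lambda>t. normal_form x t / t powr s) \<longlongrightarrow> a) (at_right 0)"
    unfolding x_def using tendsto_normal_form_iff[OF assms(1,3)] assms(5) by simp
  have "((\<lambda>t. f t / t powr s * t powr s) \<longlongrightarrow> a * 0) (at_right 0)"
    by (intro tendsto_mult assms tendsto_powr_right)
  hence "((\<lambda>t. f t / t powr s * t powr s) \<longlongrightarrow> 0) (at_right 0)" by simp
  hence "(f \<longlongrightarrow> 0) (at_right 0)"
    by (rule Lim_transform_eventually) (use ev_right_pos in eventually_elim, simp)
  hence std: "std_part x = 0"
    unfolding x_def by (rule std_part_abs_fermat[OF assms(1)])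
  have "num_terms x \<ge> 1"
  proof (rule ccontr)
    assume "\<not> num_terms x \<ge> 1"
    hence "normal_form x t = 0" for t using std by (simp add: normal_form_def)
    with lim have "((\<lambda>t::real. 0) \<longlongrightarrow> a) (at_right (0::real))" by simp
    with assms(4) show False by (simp add: tendsto_const_iff)
  qed
  moreover from this have "std_coeff x 1 \<noteq> 0" by (intro std_coeff_nonzero) auto
  ultimately have "s = 1 / fermat_order x" "a = std_coeff x 1"
    using tendsto_powr_unique[OF lim tendsto_normal_form_leading[OF std]] assms(4) by auto
  moreover have "x \<noteq> 0"
  proof
    assume "x = 0"
    hence "abs_fermat f = abs_fermat (\<lambda>_. 0)" by (simp add: x_def zero_fermat_def)
    hence "f \<in> o[at_right 0](\<lambda>t. t)"
      using abs_fermat_eq_iff[OF assms(1) little_oh_poly_const[of 0]] by simp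
    from tendsto_smallo_div_powr[OF this assms(3)] assms(4,5) show False
      using tendsto_unique[OF trivial_limit_at_right_real] by blast
  qed
  ultimately show "abs_fermat f \<in> D_inf" "abs_fermat f > 0"
    "fermat_order (abs_fermat f) = 1 / s" "std_coeff (abs_fermat f) 1 = a"
    using std assms(4) by (auto simp: D_inf_def less_fermat_0_iff fermat_pos_def x_def)
qed

section \<open>Powers computed on representatives\<close>

text \<open>The definition of \<open>inf_powr\<close> takes the power of the leading monomial and of
  the cofactor separately. By \<open>unit_powr_abs\<close> the latter is a pointwise power, and
  pointwise powers are multiplicative, so the product is the power of
  \<open>normal_form x\<close>.\<close>

lemma fermat_powr_eq_abs:
  assumes "x \<in> D_inf" "x > 0" "p > 0"
  shows "little_oh_poly (\<lambda>t. normal_form x t powr p)"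
    and "x powr\<^sub>F p = abs_fermat (\<lambda>t. normal_form x t powr p)"
proof -
  note x = pos_infinitesimal[OF assms(1,2)]
  let ?w = "fermat_order x" and ?c = "std_coeff x 1" and ?u = "leading_cofactor x"
  \<comment> \<open>The exponent is written as a double reciprocal to match
    \<open>abs_fermat_add_sum_dt\<close>, where \<open>dt w\<close> has exponent
    \<open>1 / w\<close>.\<close>
  have cof: "leading_cofactor x = (\<lambda>t. 1 + (\<Sum>i=2..num_terms x. std_coeff x i / ?c *
      t powr (1 / (1 / (1 / ord_term x i - 1 / ?w)))))"
    by (simp add: leading_cofactor_def fun_eq_iff)
  note cofactor = abs_fermat_add_sum_dt[of "{2..num_terms x}"
    "\<lambda>i. 1 / (1 / ord_term x i - 1 / ?w)" 1 "\<lambda>i. std_coeff x i / ?c"]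
  have u: "little_oh_poly ?u"
    unfolding cof by (rule cofactor(1)) (use inverse_ord_term_diff(1)[of _ x] in auto)
  have "abs_fermat ?u = of_real 1 + (\<Sum>i=2..num_terms x. (std_coeff x i / ?c) *\<^sub>R
      dt (1 / (1 / ord_term x i - 1 / ?w)))"
    unfolding cof by (rule cofactor(2)) (use inverse_ord_term_diff(1)[of _ x] in auto)
  also have "\<dots> = 1 + (\<Sum>i=2..num_terms x. (std_coeff x i / ?c) *\<^sub>R
      dt (real_of_ereal (ereal (ord_term x i) \<ominus>\<^sub>F ereal ?w)))"
    by (simp add: inverse_ord_term_diff(2))
  finally have abs_u: "1 + (\<Sum>i=2..num_terms x. (std_coeff x i / ?c) *\<^sub>R
      dt (real_of_ereal (ereal (ord_term x i) \<ominus>\<^sub>F ereal ?w))) = abs_fermat ?u" ..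
  have "std_part (abs_fermat ?u) > 0"
    using std_part_abs_fermat[OF u tendsto_leading_cofactor] by simp
  note up = unit_powr_abs[OF u this, of p]
  let ?m = "\<lambda>t::real. ?c powr p * t powr (p / ?w)"
  have m0: "little_oh_poly (\<lambda>t::real. t powr (p / ?w))"
    using x assms(3) by (intro little_oh_poly_monom) simp
  hence m: "little_oh_poly ?m" by (rule little_oh_poly_cmult)
  have "(?c powr p) *\<^sub>R dt (?w / p) = abs_fermat ?m"
    using x(4) assms(3) by (simp add: dt_def abs_fermat_scaleR[OF m0])
  hence "inf_powr x p = abs_fermat ?m * abs_fermat (\<lambda>t. ?u t powr p)"
    unfolding inf_powr_def abs_u up(2) by (rule arg_cong)
  hence "inf_powr x p = abs_fermat (\<lambda>t. ?m t * ?u t powr p)"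
    unfolding abs_fermat_mult[OF m up(1)] .
  moreover have "little_oh_poly (\<lambda>t. ?m t * ?u t powr p)" by (rule little_oh_poly_mult[OF m up(1)])
  moreover have "\<forall>\<^sub>F t in at_right 0. ?m t * ?u t powr p = normal_form x t powr p"
    using ev_right_pos by eventually_elim (simp add: normal_form_factor[OF x(1,2)] powr_mult powr_powr)
  moreover have "x powr\<^sub>F p = inf_powr x p"
    using assms x(1) by (simp add: fermat_powr_def)
  ultimately show "little_oh_poly (\<lambda>t. normal_form x t powr p)"
    "x powr\<^sub>F p = abs_fermat (\<lambda>t. normal_form x t powr p)"
    using abs_fermat_cong by metis+
qed

lemma eventually_normal_form_pos:
  assumes "x \<in> D_inf" "x > 0"
  shows "\<forall>\<^sub>F t in at_right 0. normal_form x t > 0"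
proof -
  note x = pos_infinitesimal[OF assms]
  from order_tendstoD(1)[OF tendsto_normal_form_leading[OF x(1,2)] x(3)] ev_right_pos
  show ?thesis by eventually_elim (simp add: zero_less_divide_iff)
qed

text \<open>The map \<open>u \<mapsto> u powr p\<close> is continuous at the positive leading
  coefficient.\<close>

lemma tendsto_normal_form_powr:
  assumes "x \<in> D_inf" "x > 0" "p > 0"
  shows "((\<lambda>t. normal_form x t powr p / t powr (p / fermat_order x)) \<longlongrightarrow> std_coeff x 1 powr p)
    (at_right 0)"
proof (rule Lim_transform_eventually)
  note x = pos_infinitesimal[OF assms(1,2)]
  show "((\<lambda>t. (normal_form x t / t powr (1 / fermat_order x)) powr p) \<longlongrightarrow> std_coeff x 1 powr p)
      (at_right 0)"
    by (rule tendsto_powr[OF tendsto_normal_form_leading[OF x(1,2)] tendsto_const]) (use x in simp)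
  show "\<forall>\<^sub>F t in at_right 0. (normal_form x t / t powr (1 / fermat_order x)) powr p =
      normal_form x t powr p / t powr (p / fermat_order x)"
    using ev_right_pos eventually_normal_form_pos[OF assms(1,2)]
    by eventually_elim (simp add: powr_divide powr_powr)
qed

text \<open>The leading exponent becomes \<open>p / fermat_order x\<close>; the hypothesis
  \<open>p \<le> fermat_order x\<close> says that it is at most 1, so the leading term survives
  modulo \<open>o(t)\<close>.\<close>

lemma leading_term_powr:
  assumes "x \<in> D_inf" "x > 0" "p > 0" "p \<le> fermat_order x"
  shows "x powr\<^sub>F p \<in> D_inf" "x powr\<^sub>F p > 0"
    "fermat_order (x powr\<^sub>F p) = fermat_order x / p"
    "std_coeff (x powr\<^sub>F p) 1 = std_coeff x 1 powr p"
proof -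
  note x = pos_infinitesimal[OF assms(1,2)]
  have s: "0 < p / fermat_order x" "p / fermat_order x \<le> 1" and a: "std_coeff x 1 powr p > 0"
    using x assms by auto
  from leading_term_abs_fermat[OF fermat_powr_eq_abs(1)[OF assms(1-3)] s a
      tendsto_normal_form_powr[OF assms(1-3)]]
  show "x powr\<^sub>F p \<in> D_inf" "x powr\<^sub>F p > 0"
    "fermat_order (x powr\<^sub>F p) = fermat_order x / p"
    "std_coeff (x powr\<^sub>F p) 1 = std_coeff x 1 powr p"
    by (simp_all add: fermat_powr_eq_abs(2)[OF assms(1-3)])
qed

text \<open>Now the leading exponent exceeds 1, so the whole power is \<open>o(t)\<close>. In
  contrapositive form, a nonzero power bounds the exponent by the order.\<close>

lemma powr_eq_0:
  assumes "x \<in> D_inf" "x > 0" "p > fermat_order x"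
  shows "x powr\<^sub>F p = 0"
proof -
  note x = pos_infinitesimal[OF assms(1,2)]
  have p: "p > 0" "p / fermat_order x - 1 > 0" using x(4) assms(3) by auto
  have "((\<lambda>t. normal_form x t powr p / t powr (p / fermat_order x) * t powr (p / fermat_order x - 1))
      \<longlongrightarrow> std_coeff x 1 powr p * 0) (at_right 0)"
    by (intro tendsto_mult tendsto_normal_form_powr assms p tendsto_powr_right)
  hence "((\<lambda>t. normal_form x t powr p / t powr (p / fermat_order x) * t powr (p / fermat_order x - 1))
      \<longlongrightarrow> 0) (at_right 0)" by simp
  hence "((\<lambda>t. normal_form x t powr p / t) \<longlongrightarrow> 0) (at_right 0)"
    by (rule Lim_transform_eventually) (use ev_right_pos in eventually_elim, simp add: powr_diff)
  hence "(\<lambda>t. normal_form x t powr p) \<in> o[at_right 0](\<lambda>t. t)"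
    by (rule smalloI_tendsto) (use ev_right_pos in eventually_elim, simp)
  with abs_fermat_eq_iff[OF fermat_powr_eq_abs(1)[OF assms(1,2) p(1)] little_oh_poly_const[of 0]]
  show ?thesis
    by (simp add: fermat_powr_eq_abs(2)[OF assms(1,2) p(1)] zero_fermat_def)
qed

section \<open>Error propagation and bounds on the order\<close>

text \<open>Mean value theorem: for \<open>q \<ge> 1\<close> the derivative
  \<open>q * z powr (q - 1)\<close> is at most \<open>q\<close> on \<open>(0, 1]\<close>.\<close>

lemma abs_powr_diff_le:
  fixes a b q :: real
  assumes "q \<ge> 1" "0 < a" "a \<le> 1" "0 < b" "b \<le> 1"
  shows "\<bar>a powr q - b powr q\<bar> \<le> q * \<bar>a - b\<bar>"
proof -
  have "\<bar>v powr q - u powr q\<bar> \<le> q * \<bar>v - u\<bar>" if "0 < u" "u < v" "v \<le> 1" for u v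
  proof -
    have "\<exists>z>u. z < v \<and> v powr q - u powr q = (v - u) * (q * z powr (q - 1))"
      using that by (intro MVT2) (auto intro!: derivative_eq_intros)
    then obtain z where z: "u < z" "z < v" "v powr q - u powr q = (v - u) * (q * z powr (q - 1))"
      by blast
    moreover have "z powr (q - 1) \<le> 1" using z that assms(1) by (intro powr_le1) auto
    ultimately show ?thesis
      using that assms(1) by (simp add: abs_mult mult.commute mult_left_le)
  qed
  from this[of a b] this[of b a] assms show ?thesis
    by (cases a b rule: linorder_cases) (auto simp: abs_minus_commute)
qed

text \<open>The limits 0 put both functions eventually below 1, where the Lipschitz bound
  applies.\<close>

lemma powr_diff_smallo:
  assumes "q \<ge> 1" "\<forall>\<^sub>F t in at_right 0. f t > 0" "\<forall>\<^sub>F t in at_right 0. g t > 0"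
    and "(f \<longlongrightarrow> 0) (at_right 0)" "(g \<longlongrightarrow> 0) (at_right 0)"
    and "(\<lambda>t. f t - g t) \<in> o[at_right 0](\<lambda>t. t)"
  shows "(\<lambda>t. f t powr q - g t powr q :: real) \<in> o[at_right 0](\<lambda>t. t)"
proof (rule landau_o.big_small_trans[OF bigoI assms(6)])
  show "\<forall>\<^sub>F t in at_right 0. norm (f t powr q - g t powr q) \<le> q * norm (f t - g t)"
    using assms(2,3) order_tendstoD(2)[OF assms(4) zero_less_one]
      order_tendstoD(2)[OF assms(5) zero_less_one]
    by eventually_elim (use assms(1) in \<open>auto intro: abs_powr_diff_le\<close>)
qed

text \<open>If the order \<open>w\<close> exceeded \<open>k\<close>, the scale
  \<open>s = 1 / w\<close> would satisfy \<open>k * s < 1\<close>, yet the limit there is the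
  nonzero leading coefficient. The form \<open>k * s < 1\<close> instead of \<open>s < 1 / k\<close>
  also covers \<open>k = 0\<close>.\<close>

lemma fermat_order_le:
  assumes "little_oh_poly f" "k \<ge> 0"
    and lim: "\<And>s. 0 \<le> s \<Longrightarrow> s \<le> 1 \<Longrightarrow> k * s < 1 \<Longrightarrow> ((\<lambda>t. f t / t powr s) \<longlongrightarrow> 0) (at_right 0)"
  shows "fermat_order (abs_fermat f) \<le> k"
proof (rule ccontr)
  define x where "x = abs_fermat f"
  assume "\<not> fermat_order (abs_fermat f) \<le> k"
  hence order: "fermat_order x > k" by (simp add: x_def)
  \<comment> \<open>Without infinitesimal terms the order is 0 by default, which cannot exceed
    \<open>k \<ge> 0\<close>.\<close>
  with assms(2) have N: "num_terms x \<ge> 1"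
    by (simp add: fermat_order_def ord_term_def split: if_splits)
  have ge_1: "fermat_order x \<ge> 1"
    unfolding fermat_order_def using N by (intro ord_term_ge_1) auto
  have "((\<lambda>t. f t / t powr 0) \<longlongrightarrow> 0) (at_right 0)" by (rule lim) auto
  hence "(f \<longlongrightarrow> 0) (at_right 0)"
    by (rule Lim_transform_eventually) (use ev_right_pos in eventually_elim, simp)
  hence std: "std_part x = 0" unfolding x_def by (rule std_part_abs_fermat[OF assms(1)])
  have "((\<lambda>t. f t / t powr (1 / fermat_order x)) \<longlongrightarrow> 0) (at_right 0)"
    using order ge_1 by (intro lim) auto
  hence "((\<lambda>t. normal_form x t / t powr (1 / fermat_order x)) \<longlongrightarrow> 0) (at_right 0)"
    unfolding x_def using ge_1 by (intro tendsto_normal_form_iff[OF assms(1), THEN iffD2])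
      (auto simp: x_def)
  with tendsto_normal_form_leading[OF std N] have "std_coeff x 1 = 0"
    using tendsto_unique[OF trivial_limit_at_right_real] by blast
  with std_coeff_nonzero[of 1 x] N show False by simp
qed

text \<open>Standard parts and leading terms cancel in the difference. The remaining terms have
  order at most \<open>k\<close>, hence vanish against every \<open>t powr s\<close> with
  \<open>k * s < 1\<close>, as \<open>fermat_order_le\<close> requires.\<close>

lemma eq_upto_leading_term:
  assumes "std_part x = std_part y" "num_terms x \<ge> 1" "num_terms y \<ge> 1"
    and "fermat_order x = fermat_order y" "std_coeff x 1 = std_coeff y 1"
    and "ord_term x 2 \<le> k" "ord_term y 2 \<le> k" "k \<ge> 0"
  shows "eq_upto k x y"
proof -
  define R where "R z t = (\<Sum>i=2..num_terms z. std_coeff z i * t powr (1 / ord_term z i))"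
    for z and t :: real
  have nf: "normal_form z t = std_part z + std_coeff z 1 * t powr (1 / fermat_order z) + R z t"
    if "num_terms z \<ge> 1" for z t
    using that
    by (simp add: normal_form_def R_def fermat_order_def sum.atLeast_Suc_atMost numeral_2_eq_2)
  have R: "((\<lambda>t. R z t / t powr s) \<longlongrightarrow> 0) (at_right 0)"
    if z: "ord_term z 2 \<le> k" and s: "0 \<le> s" "k * s < 1" for z s
  proof (rule Lim_transform_eventually)
    have "1 / ord_term z i - s > 0" if i: "i \<in> {2..num_terms z}" for i
    proof -
      have "ord_term z i \<le> ord_term z 2"
        using ord_term_less[of 2 i z] i by (cases "i = 2") auto
      \<comment> \<open>From \<open>ord_term z i * s \<le> k * s < 1\<close> the exponent of each
        remaining term stays positive after division by \<open>t powr s\<close>.\<close>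
      hence "ord_term z i * s \<le> k * s" using z s by (intro mult_right_mono) auto
      moreover have "ord_term z i \<ge> 1" using i by (intro ord_term_ge_1) auto
      ultimately show ?thesis using s by (simp add: field_simps)
    qed
    hence "((\<lambda>t. \<Sum>i=2..num_terms z. std_coeff z i * t powr (1 / ord_term z i - s)) \<longlongrightarrow>
        (\<Sum>i=2..num_terms z. std_coeff z i * 0)) (at_right 0)"
      by (intro tendsto_intros tendsto_powr_right)
    thus "((\<lambda>t. \<Sum>i=2..num_terms z. std_coeff z i * t powr (1 / ord_term z i - s)) \<longlongrightarrow> 0) (at_right 0)"
      by simp
    show "\<forall>\<^sub>F t in at_right 0. (\<Sum>i=2..num_terms z. std_coeff z i * t powr (1 / ord_term z i - s)) =
        R z t / t powr s"
      using ev_right_pos by eventually_elim (simp add: R_def sum_divide_distrib powr_diff)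
  qed
  \<comment> \<open>The difference is a sum with a multiple by -1, so that the rules for
    \<open>abs_fermat\<close> of sums and scalar multiples apply.\<close>
  let ?f = "\<lambda>t. normal_form x t + (-1) * normal_form y t"
  have f: "?f t = R x t - R y t" for t
    using assms(1,4,5) by (simp add: nf[OF assms(2)] nf[OF assms(3)])
  have "abs_fermat ?f = x - y"
    using abs_fermat_add[OF little_oh_poly_normal_form[of x]
        little_oh_poly_cmult[OF little_oh_poly_normal_form[of y], of "-1"]]
      abs_fermat_scaleR[OF little_oh_poly_normal_form[of y], of "-1"]
    by (simp add: abs_fermat_normal_form diff_conv_add_uminus del: add_uminus_conv_diff)
  moreover have "fermat_order (abs_fermat ?f) \<le> k"
  proof (rule fermat_order_le[OF _ assms(8)])
    show "little_oh_poly ?f"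
      by (intro little_oh_poly_add little_oh_poly_cmult little_oh_poly_normal_form)
    show "((\<lambda>t. ?f t / t powr s) \<longlongrightarrow> 0) (at_right 0)" if "0 \<le> s" "k * s < 1" for s
      unfolding f diff_divide_distrib
      using tendsto_diff[OF R[OF assms(6) that] R[OF assms(7) that]] by simp
  qed
  ultimately show ?thesis using assms(1) by (simp add: eq_upto_def)
qed

section \<open>Composing reciprocal powers\<close>

text \<open>The functions \<open>?g\<close> and \<open>?f powr p\<close> represent the same element.
  Raising both to the exponent \<open>1 / p \<ge> 1\<close> keeps their difference
  \<open>o(t)\<close> and, as \<open>?f\<close> is eventually positive, turns the second into
  \<open>?f\<close>.\<close>

lemma powr_powr_inverse:
  assumes "x \<in> D_inf" "x > 0" "0 < p" "p < 1"
  shows "(x powr\<^sub>F p) powr\<^sub>F (1 / p) = x"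
proof -
  define y where "y = x powr\<^sub>F p"
  let ?f = "normal_form x" and ?g = "normal_form y"
  have x: "std_part x = 0" "fermat_order x \<ge> 1" using pos_infinitesimal[OF assms(1,2)] by auto
  \<comment> \<open>Here \<open>p < 1 \<le> fermat_order x\<close>, so the leading term of the power
    survives.\<close>
  have y: "y \<in> D_inf" "y > 0"
    unfolding y_def using assms x(2) by (auto intro: leading_term_powr)
  have q: "1 / p > 0" "1 / p \<ge> 1" using assms by auto
  note fp = fermat_powr_eq_abs[OF assms(1-3)]
  have f_pos: "\<forall>\<^sub>F t in at_right 0. ?f t > 0" by (rule eventually_normal_form_pos[OF assms(1,2)])
  have g_lim: "(?g \<longlongrightarrow> 0) (at_right 0)"
    using tendsto_normal_form[of y] y(1) by (simp add: D_inf_def)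
  have "(?f \<longlongrightarrow> 0) (at_right 0)" using tendsto_normal_form[of x] x by simp
  \<comment> \<open>For a base tending to 0, \<open>tendsto_powr'\<close> asks for an eventually
    nonnegative base and a positive limit exponent.\<close>
  moreover have "\<forall>\<^sub>F t in at_right 0. ?f t \<ge> 0" using f_pos by eventually_elim simp
  ultimately have fp_lim: "((\<lambda>t. ?f t powr p) \<longlongrightarrow> 0) (at_right 0)"
    using tendsto_powr'[of ?f 0 "at_right 0" "\<lambda>_. p" p] assms(3) by simp
  have "(\<lambda>t. ?g t powr (1 / p) - (?f t powr p) powr (1 / p)) \<in> o[at_right 0](\<lambda>t. t)"
  proof (rule powr_diff_smallo[OF q(2) _ _ g_lim fp_lim])
    show "\<forall>\<^sub>F t in at_right 0. ?g t > 0" by (rule eventually_normal_form_pos[OF y])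
    show "\<forall>\<^sub>F t in at_right 0. ?f t powr p > 0" using f_pos by eventually_elim simp
    show "(\<lambda>t. ?g t - ?f t powr p) \<in> o[at_right 0](\<lambda>t. t)"
      unfolding y_def fp(2) by (rule normal_form_diff_smallo[OF fp(1)])
  qed
  also have "?this \<longleftrightarrow> (\<lambda>t. ?g t powr (1 / p) - ?f t) \<in> o[at_right 0](\<lambda>t. t)"
    using f_pos assms(3)
    by (intro landau_o.small.in_cong) (auto elim!: eventually_mono simp: powr_powr)
  finally have "abs_fermat (\<lambda>t. ?g t powr (1 / p)) = abs_fermat ?f"
    using abs_fermat_eq_iff[OF fermat_powr_eq_abs(1)[OF y q(1)] little_oh_poly_normal_form] by simp
  thus ?thesis
    using fermat_powr_eq_abs(2)[OF y q(1)] by (simp add: abs_fermat_normal_form y_def)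
qed

text \<open>The leading order goes from \<open>w\<close> to \<open>p * w\<close> and back to
  \<open>w\<close>, the leading coefficient from \<open>c\<close> to \<open>c powr (1 / p)\<close>
  and back to \<open>c\<close>. So \<open>z\<close> and \<open>x\<close> can differ only from the
  second term on.\<close>

lemma inverse_powr_powr_eq_upto:
  assumes "x \<in> D_inf" "x > 0" "0 < p" "p < 1" "x powr\<^sub>F (1 / p) \<noteq> 0"
  defines "z \<equiv> (x powr\<^sub>F (1 / p)) powr\<^sub>F p"
  shows "eq_upto (max (ord_term x 2) (ord_term z 2)) z x"
proof -
  define y where "y = x powr\<^sub>F (1 / p)"
  note x = pos_infinitesimal[OF assms(1,2)]
  have q: "1 / p > 0" using assms by simp
  have "1 / p \<le> fermat_order x" using powr_eq_0[OF assms(1,2), of "1 / p"] assms(5) by force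
  note y = leading_term_powr[OF assms(1,2) q this, folded y_def]
  \<comment> \<open>The second power needs no further assumption: \<open>y\<close> is a positive
    infinitesimal, so its order is at least \<open>1 > p\<close>.\<close>
  have "p \<le> fermat_order y" using pos_infinitesimal(4)[OF y(1,2)] assms(4) by simp
  note z = leading_term_powr[OF y(1,2) assms(3) this, folded z_def[folded y_def]]
  note z' = pos_infinitesimal[OF z(1,2)]
  \<comment> \<open>If \<open>x\<close> has no second term, \<open>ord_term x 2\<close> is 0 by
    default.\<close>
  have nonneg: "ord_term x 2 \<ge> 0"
    using ord_term_ge_1[of 2 x] by (cases "2 \<in> {1..num_terms x}") (auto simp: ord_term_def)
  show ?thesis
    by (rule eq_upto_leading_term)
      (use x z z' y assms(3) nonneg in \<open>auto simp: powr_powr\<close>)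
qed

theorem theorem27:
  fixes x :: fermat and p :: real
  assumes "x \<in> D_inf" and "x > 0" and "0 < p" and "p < 1"
  shows "(x powr\<^sub>F p) powr\<^sub>F (1 / p) = x \<and>
    (x powr\<^sub>F (1 / p) \<noteq> 0 \<longrightarrow>
      (let k = max (ord_term x 2) (ord_term ((x powr\<^sub>F (1 / p)) powr\<^sub>F p) 2)
       in eq_upto k ((x powr\<^sub>F (1 / p)) powr\<^sub>F p) x))"
  using powr_powr_inverse[OF assms] inverse_powr_powr_eq_upto[OF assms] by (simp add: Let_def)

end
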